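(* Assume GRH. Let $\ell$ be an odd prime and $\chi$ a character of order $\ell$ and conductor $q$. Then, as $q\to\infty$, $$\frac{C_\ell}{\left(2e^\gamma\log_2q\right)^{\cos(\pi/\ell)}}(1+o(1))\le|L(1,\chi)|\le 2e^\gamma\log_2q\,(1+o(1)),$$ where $$C_\ell=\prod_p\left[\left(1-\frac1p\right)^{-\cos(\pi/\ell)}\left(1+\frac{2\cos(\pi/\ell)}{p}+\frac1{p^2}\right)^{-1/2}\right].$$
   Context: $\gamma$ is Euler's constant, $\log_2q=\log\log q$. *)

theory Defs
  imports "HOL-Analysis.Analysis" "HOL-Number_Theory.Cong"
begin

definition dirichlet_char :: "nat \<Rightarrow> (nat \<Rightarrow> complex) \<Rightarrow> bool" where
  "dirichlet_char q chi \<longleftrightarrow> q > 0 \<and> (\<forall>m n. chi (m * n) = chi m * chi n)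
     \<and> (\<forall>n. chi (n + q) = chi n) \<and> (\<forall>n. chi n = 0 \<longleftrightarrow> \<not> coprime n q)"

definition principal_char :: "nat \<Rightarrow> (nat \<Rightarrow> complex) \<Rightarrow> bool" where
  "principal_char q chi \<longleftrightarrow> (\<forall>n. coprime n q \<longrightarrow> chi n = 1)"

definition dchar_order :: "nat \<Rightarrow> (nat \<Rightarrow> complex) \<Rightarrow> nat" where
  "dchar_order q chi = (LEAST k. k > 0 \<and> (\<forall>n. coprime n q \<longrightarrow> chi n ^ k = 1))"

definition dchar_conductor :: "nat \<Rightarrow> (nat \<Rightarrow> complex) \<Rightarrow> nat" where
  "dchar_conductor q chi = (LEAST d. d > 0 \<and> d dvd q \<and>
      (\<forall>m n. coprime m q \<longrightarrow> coprime n q \<longrightarrow> [m = n] (mod d) \<longrightarrow> chi m = chi n))"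

text \<open>Dirichlet L-function given by its (conditionally convergent) series
  \<open>\<Sum>_{n\<ge>1} chi(n) n^{-s}\<close>; the n = 0 term vanishes. For non-principal chi
  this converges for Re s > 0, which covers the critical strip and s = 1.\<close>
definition dirichlet_L :: "(nat \<Rightarrow> complex) \<Rightarrow> complex \<Rightarrow> complex" where
  "dirichlet_L chi s = (\<Sum>n. chi n / (of_nat n) powr s)"

definition GRH :: bool where
  "GRH \<longleftrightarrow> (\<forall>q chi s. dirichlet_char q chi \<and> \<not> principal_char q chi \<and>
      0 < Re s \<and> Re s < 1 \<and> dirichlet_L chi s = 0 \<longrightarrow> Re s = 1/2)"

definition C_const :: "nat \<Rightarrow> real" where
  "C_const l = lim (\<lambda>x. \<Prod>p\<in>{p. prime p \<and> p \<le> x}.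
      (1 - 1 / real p) powr (- cos (pi / real l)) *
      (1 + 2 * cos (pi / real l) / real p + 1 / (real p)^2) powr (-1/2))"

end

theory Submission
  imports Defs "HOL-Complex_Analysis.Complex_Analysis" "HOL-Number_Theory.Residues"
begin

text \<open>
  Fix \<open>r > 0\<close>. The Taylor polynomial of degree \<open>K\<close> of \<open>n\<^sup>-\<^sup>s\<close> at \<open>1 + r\<close>, evaluated at \<open>s = 1\<close>, is
  \<open>w\<^sub>K(n) / n\<close>, where \<open>w\<^sub>K(n) \<in> [0,1]\<close> is the probability that a Poisson variable of mean \<open>r ln n\<close> is
  at most \<open>K\<close>. Hence the degree \<open>K\<close> Taylor polynomial of \<open>\<Sum>\<^sub>p \<chi>(p) p\<^sup>-\<^sup>s\<close> takes the value
  \<open>\<Sum>\<^sub>p \<chi>(p) w\<^sub>K(p) / p\<close> at \<open>1\<close>. Under GRH \<open>log L(s, \<chi>)\<close> is holomorphic on a disc of radius \<open>R\<close>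
  almost \<open>r + 1/2\<close> around \<open>1 + r\<close> and \<open>O(log q)\<close> there (Borel-Caratheodory), so the truncation error
  at \<open>s = 1\<close> is \<open>O((r / R)\<^sup>K log q)\<close>. For large \<open>r\<close> this is \<open>o(1)\<close> already for
  \<open>K = (2 + \<delta>) r log log q\<close>.

  For the zeta function the same truncation, applied to \<open>log ((s - 1) \<zeta>(s)) - log (s - 1)\<close>, gives
  \<open>- log r + \<Sum>\<^sub>k\<^sub>\<le>\<^sub>K 1/k + o(1) = log (K / r) + \<gamma> + o(1)\<close>, which replaces Mertens' theorem. Comparing the
  two weighted sums prime by prime, with \<open>-cos (\<pi> / l) \<le> Re \<chi>(p) \<le> 1\<close>, yields both bounds; the
  contributions of higher prime powers converge by dominated convergence.
\<close>

section \<open>Dirichlet series with bounded partial sums\<close>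

text \<open>The disc of radius \<open>r\<close> around \<open>1 + r\<close> touches the line Re s =
  1 exactly at s = 1, and GRH lets log L continue almost 1/2 further. Truncation therefore gains
  about (1 + 1/(2r))^(-K), and beating log q takes K > log log q / ln (1 + 1/(2r)), which for large
  \<open>r\<close> is close to 2 r log log q. The auxiliary \<open>r\<close> cancels because the
  zeta sum sees only K / r; the 2 in both bounds is the reciprocal of the distance 1/2 to the
  critical line.

  Smooth weights in place of a cutoff p <= x avoid explicit formulas and counting of zeros. Zeta
  needs no hypothesis: only a neighbourhood of the closed disc matters, and that disc meets Re s = 1
  only at s = 1. For L, GRH as formulated is silent about Re s = 1, so that line is handled by the
  3-4-1 inequality, which wants the square of the character to be nonprincipal; odd order provides
  this.

  To reach the constant C_l whole Euler factors are compared, not only their linear terms. The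
  extremal value of chi(p) is -exp (i pi / l), an l-th root of unity for odd l.\<close>

lemma holomorphic_on_suminf_halfplane:
  fixes f :: "nat \<Rightarrow> complex \<Rightarrow> complex"
  assumes hol: "\<And>n. f n holomorphic_on {s. Re s > a}"
    and bound: "\<And>b B. b > a \<Longrightarrow> \<exists>M. summable M \<and> (\<forall>n s. Re s \<ge> b \<longrightarrow> norm s \<le> B \<longrightarrow> norm (f n s) \<le> M n)"
  shows "(\<lambda>s. \<Sum>n. f n s) holomorphic_on {s. Re s > a}"
proof (rule holomorphic_uniform_sequence[where f = "\<lambda>n s. \<Sum>i<n. f i s"])
  show "open {s. Re s > a}" by (rule open_halfspace_Re_gt)
  show "(\<lambda>s. \<Sum>i<n. f i s) holomorphic_on {s. Re s > a}" for n
    by (intro holomorphic_intros hol)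
next
  fix x assume "x \<in> {s. Re s > a}"
  define d where "d = (Re x - a) / 2"
  have d: "d > 0" using \<open>x \<in> _\<close> by (simp add: d_def)
  have re: "Re s \<ge> a + d" "norm s \<le> norm x + d" if "s \<in> cball x d" for s
  proof -
    have "\<bar>Re (x - s)\<bar> \<le> d"
      using abs_Re_le_cmod[of "x - s"] that by (simp add: dist_norm)
    moreover have "Re x = a + 2 * d" by (simp add: d_def field_simps)
    ultimately show "Re s \<ge> a + d" by simp
    have "norm s \<le> norm x + norm (s - x)" by norm
    thus "norm s \<le> norm x + d" using that by (simp add: dist_norm norm_minus_commute)
  qed
  obtain M where M: "summable M" "\<And>n s. Re s \<ge> a + d \<Longrightarrow> norm s \<le> norm x + d \<Longrightarrow> norm (f n s) \<le> M n"
    using bound[of "a + d" "norm x + d"] d by auto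
  have "uniform_limit (cball x d) (\<lambda>n s. \<Sum>i<n. f i s) (\<lambda>s. \<Sum>n. f n s) sequentially"
    by (rule Weierstrass_m_test) (use M re in auto)
  moreover have "cball x d \<subseteq> {s. Re s > a}" using re d by fastforce
  ultimately show "\<exists>d. 0 < d \<and> cball x d \<subseteq> {s. Re s > a} \<and>
      uniform_limit (cball x d) (\<lambda>n s. \<Sum>i<n. f i s) (\<lambda>s. \<Sum>n. f n s) sequentially"
    using d by blast
qed

lemma suminf_dominated_convergence:
  fixes a :: "nat \<Rightarrow> nat \<Rightarrow> 'a :: {real_normed_algebra, banach}"
  assumes "\<And>n. (\<lambda>N. a N n) \<longlonglongrightarrow> b n" "\<And>N n. norm (a N n) \<le> M n" "summable M"
  shows "(\<lambda>N. \<Sum>n. a N n) \<longlonglongrightarrow> suminf b"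
proof -
  have "\<forall>\<^sub>F (n, N) in sequentially \<times>\<^sub>F sequentially. norm (a N n) \<le> M n"
    using assms(2) by (intro always_eventually) auto
  from tannerys_theorem[OF assms(1) this assms(3)] show ?thesis by simp
qed

lemma summable_inverse_powr: "\<sigma> > 1 \<Longrightarrow> summable (\<lambda>n. 1 / real n powr \<sigma>)"
  using summable_real_powr_iff[of "-\<sigma>"] by (simp add: powr_minus_divide)

lemma norm_of_nat_powr: "norm (of_nat n powr s :: complex) = real n powr Re s"
  by (cases "n = 0") (simp_all add: norm_powr_real_powr)

lemma norm_divide_nat_powr: "norm (x / of_nat n powr s :: complex) = norm x / real n powr Re s"
  by (simp add: norm_divide norm_of_nat_powr)

lemma inverse_powr_mono:
  assumes "b \<le> \<sigma>" shows "1 / real n powr \<sigma> \<le> 1 / real n powr b"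
proof (cases "n = 0")
  case False
  thus ?thesis using assms by (intro divide_left_mono powr_mono) auto
qed auto

lemma summable_dirichlet:
  fixes x :: "nat \<Rightarrow> complex"
  assumes "\<And>n. norm (x n) \<le> 1" "Re s > 1"
  shows "summable (\<lambda>n. norm (x n / of_nat n powr s))"
  by (rule summable_comparison_test'[OF summable_inverse_powr[OF assms(2)], of 0])
     (use assms(1) in \<open>auto simp: norm_divide_nat_powr intro!: divide_right_mono\<close>)

lemma has_field_derivative_powr_segment:
  assumes "x \<in> closed_segment (of_nat n) (of_nat (Suc n))" "n > 0"
  shows "((\<lambda>x. x powr w) has_field_derivative w * x powr (w - 1)) (at x)"
    "norm (x powr w) = Re x powr Re w" "Re x \<ge> real n"
proof -
  have "of_nat n = complex_of_real (real n)" "of_nat (Suc n) = complex_of_real (real (Suc n))"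
    by simp_all
  with assms have "x \<in> complex_of_real ` {real n..real (Suc n)}"
    by (metis closed_segment_of_real closed_segment_eq_real_ivl1 of_nat_le_iff le_SucI order_refl)
  then obtain u where u: "x = of_real u" "u \<ge> real n" by auto
  have "u > 0" using u assms by linarith
  show "norm (x powr w) = Re x powr Re w" "Re x \<ge> real n"
    using u \<open>u > 0\<close> by (simp_all add: norm_powr_real_powr)
  show "((\<lambda>x. x powr w) has_field_derivative w * x powr (w - 1)) (at x)"
    using u \<open>u > 0\<close> by (intro has_field_derivative_powr) (auto simp: complex_nonpos_Reals_iff)
qed

lemma norm_diff_powr_le:
  assumes "Re s > 0" and n: "n > 0"
  shows "norm (1 / of_nat n powr s - 1 / of_nat (Suc n) powr s) \<le> norm s / real n powr (Re s + 1)"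
proof -
  have "norm ((of_nat n) powr (-s) - (of_nat (Suc n)) powr (-s)) \<le>
     (norm s * real n powr (- Re s - 1)) * norm (of_nat n - of_nat (Suc n) :: complex)"
  proof (rule field_differentiable_bound[OF convex_closed_segment])
    fix z :: complex assume z: "z \<in> closed_segment (of_nat n) (of_nat (Suc n))"
    note d = has_field_derivative_powr_segment[OF z n]
    show "((\<lambda>x. x powr (-s)) has_field_derivative (-s) * z powr (-s - 1)) 
            (at z within closed_segment (of_nat n) (of_nat (Suc n)))"
      by (rule has_field_derivative_at_within[OF d(1)])
    have "Re z powr (- Re s - 1) \<le> real n powr (- Re s - 1)"
      using d(3) assms n by (intro powr_mono2') auto
    thus "norm ((-s) * z powr (-s - 1)) \<le> norm s * real n powr (- Re s - 1)"
      by (auto simp: norm_mult d(2) intro!: mult_left_mono)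
  qed auto
  also have "norm (of_nat n - of_nat (Suc n) :: complex) = 1" by simp
  finally have *: "norm (1 / of_nat n powr s - 1 / of_nat (Suc n) powr s) \<le> norm s * real n powr (- Re s - 1)"
    by (simp add: powr_minus_divide)
  have "real n powr (- Re s - 1) = 1 / real n powr (Re s + 1)"
    using powr_minus_divide[of "real n" "Re s + 1"] by simp
  thus ?thesis using * by simp
qed

text \<open>Abel summation; the terms with index \<open>0\<close> vanish because \<open>1 / 0 = 0\<close>.\<close>

lemma sum_dirichlet_by_parts:
  fixes x :: "nat \<Rightarrow> complex"
  assumes "x 0 = 0"
  shows "(\<Sum>k<Suc N. x k / of_nat k powr s) =
    (\<Sum>k<Suc N. (\<Sum>j\<le>k. x j) * (1 / of_nat k powr s - 1 / of_nat (Suc k) powr s))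
      + (\<Sum>j\<le>N. x j) / of_nat (Suc N) powr s"
proof (induction N)
  case 0 thus ?case using assms by simp
next
  case (Suc N)
  show ?case
    apply (subst (1 2) sum.lessThan_Suc)
    apply (subst Suc.IH)
    apply (simp add: algebra_simps diff_divide_distrib add_divide_distrib)
    done
qed

context
  fixes x :: "nat \<Rightarrow> complex" and B :: real
  assumes x0: "x 0 = 0" and B: "\<And>n. norm (\<Sum>j\<le>n. x j) \<le> B"
begin

private lemma B_nonneg: "B \<ge> 0"
  using B[of 0] norm_ge_zero order_trans by blast

private lemma norm_term_le:
  assumes "Re s > 0"
  shows "norm ((\<Sum>j\<le>k. x j) * (1 / of_nat k powr s - 1 / of_nat (Suc k) powr s))
     \<le> B * norm s * (1 / real k powr (Re s + 1))"
proof (cases "k = 0")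
  case False
  hence "norm (1 / of_nat k powr s - 1 / of_nat (Suc k) powr s) \<le> norm s / real k powr (Re s + 1)"
    using assms by (intro norm_diff_powr_le) auto
  hence "norm (\<Sum>j\<le>k. x j) * norm (1 / of_nat k powr s - 1 / of_nat (Suc k) powr s)
     \<le> B * (norm s / real k powr (Re s + 1))"
    using B B_nonneg by (intro mult_mono) auto
  thus ?thesis unfolding norm_mult by simp
qed (simp add: x0)

private lemma summable_term:
  assumes "Re s > 0"
  shows "summable (\<lambda>k. norm ((\<Sum>j\<le>k. x j) * (1 / of_nat k powr s - 1 / of_nat (Suc k) powr s)))"
proof (rule summable_comparison_test')
  show "summable (\<lambda>k. B * norm s * (1 / real k powr (Re s + 1)))"
    using assms by (intro summable_mult summable_inverse_powr) auto
qed (use norm_term_le[OF assms] in auto)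

text \<open>For 0 < Re s <= 1 the defining series need not converge absolutely, so the Weierstrass
  test does not apply to it. After Abel summation the terms are O(k^(-Re s - 1)), locally uniformly
  in s; holomorphy and growth are then read off from that series.\<close>

lemma dirichlet_L_sums_bounded_partial_sums:
  assumes s: "Re s > 0"
  shows "(\<lambda>n. x n / of_nat n powr s) sums
     (\<Sum>k. (\<Sum>j\<le>k. x j) * (1 / of_nat k powr s - 1 / of_nat (Suc k) powr s))"
proof -
  let ?t = "\<lambda>k. (\<Sum>j\<le>k. x j) * (1 / of_nat k powr s - 1 / of_nat (Suc k) powr s)"
  have "(\<lambda>N. (\<Sum>k<Suc N. ?t k)) \<longlonglongrightarrow> suminf ?t"
    using summable_LIMSEQ[OF summable_norm_cancel[OF summable_term[OF s]]]
    by (subst filterlim_sequentially_Suc)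
  moreover have "(\<lambda>N. (\<Sum>j\<le>N. x j) / of_nat (Suc N) powr s) \<longlonglongrightarrow> 0"
  proof (rule Lim_null_comparison)
    show "\<forall>\<^sub>F N in sequentially. norm ((\<Sum>j\<le>N. x j) / of_nat (Suc N) powr s) \<le> B * real (Suc N) powr (- Re s)"
      using B by (intro always_eventually allI)
        (auto simp: norm_divide_nat_powr powr_minus_divide simp del: of_nat_Suc intro!: divide_right_mono)
    have "(\<lambda>N. real N powr (- Re s)) \<longlonglongrightarrow> 0"
      using s by (intro tendsto_neg_powr filterlim_real_sequentially) auto
    hence "(\<lambda>N. real (Suc N) powr (- Re s)) \<longlonglongrightarrow> 0"
      by (rule LIMSEQ_Suc)
    thus "(\<lambda>N. B * real (Suc N) powr (- Re s)) \<longlonglongrightarrow> 0"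
      by (rule tendsto_mult_right_zero)
  qed
  ultimately have "(\<lambda>N. \<Sum>k<Suc N. x k / of_nat k powr s) \<longlonglongrightarrow> suminf ?t + 0"
    unfolding sum_dirichlet_by_parts[where x = x, OF x0] by (rule tendsto_add)
  thus ?thesis unfolding sums_def
    by (subst (asm) filterlim_sequentially_Suc) auto
qed

lemma dirichlet_L_bounded_partial_sums:
  assumes s: "Re s > 0"
  shows "dirichlet_L x s =
     (\<Sum>k. (\<Sum>j\<le>k. x j) * (1 / of_nat k powr s - 1 / of_nat (Suc k) powr s))"
  unfolding dirichlet_L_def using sums_unique[OF dirichlet_L_sums_bounded_partial_sums[OF s]] by simp

lemma holomorphic_dirichlet_L: "dirichlet_L x holomorphic_on {s. Re s > 0}"
proof -
  have "(\<lambda>s. \<Sum>k. (\<Sum>j\<le>k. x j) * (1 / of_nat k powr s - 1 / of_nat (Suc k) powr s))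
    holomorphic_on {s. Re s > 0}"
  proof (rule holomorphic_on_suminf_halfplane)
    fix k
    show "(\<lambda>s. (\<Sum>j\<le>k. x j) * (1 / of_nat k powr s - 1 / of_nat (Suc k) powr s))
        holomorphic_on {s. Re s > 0}"
    proof (cases "k = 0")
      case False
      have "of_nat (Suc k) \<noteq> (0::complex)" by (simp del: of_nat_Suc)
      with False show ?thesis
        by (intro holomorphic_intros) (auto simp del: of_nat_Suc)
    qed (simp add: x0)
  next
    fix b C :: real assume b: "b > 0"
    show "\<exists>M. summable M \<and> (\<forall>n s. b \<le> Re s \<longrightarrow> cmod s \<le> C \<longrightarrow>
       norm ((\<Sum>j\<le>n. x j) * (1 / of_nat n powr s - 1 / of_nat (Suc n) powr s)) \<le> M n)"
    proof (intro exI[of _ "\<lambda>k. B * C * (1 / real k powr (b + 1))"] conjI allI impI)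
      show "summable (\<lambda>k. B * C * (1 / real k powr (b + 1)))"
        using b by (intro summable_mult summable_inverse_powr) auto
      fix k s assume s: "b \<le> Re s" "norm s \<le> C"
      have C: "C \<ge> 0" using s norm_ge_zero order_trans by blast
      have "norm ((\<Sum>j\<le>k. x j) * (1 / of_nat k powr s - 1 / of_nat (Suc k) powr s))
       \<le> B * norm s * (1 / real k powr (Re s + 1))"
        using s b by (intro norm_term_le) auto
      also have "\<dots> \<le> B * C * (1 / real k powr (b + 1))"
        using s B_nonneg C by (intro mult_mono inverse_powr_mono) auto
      finally show "norm ((\<Sum>j\<le>k. x j) * (1 / of_nat k powr s - 1 / of_nat (Suc k) powr s))
        \<le> B * C * (1 / real k powr (b + 1))" .
    qed
  qed
  thus ?thesis
    by (rule holomorphic_transform) (simp add: dirichlet_L_bounded_partial_sums)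
qed

text \<open>The bound is linear in \<open>B\<close>. For a character \<open>B\<close> is the modulus
  q, so ln |L| is at most ln q + O(1) on bounded sets; this is how ln q enters the truncation
  error.\<close>

lemma norm_dirichlet_L_le:
  assumes "Re s \<ge> 1/2"
  shows "norm (dirichlet_L x s) \<le> B * norm s * (\<Sum>n. 1 / real n powr (3/2))"
proof -
  let ?t = "\<lambda>k. (\<Sum>j\<le>k. x j) * (1 / of_nat k powr s - 1 / of_nat (Suc k) powr s)"
  have s: "Re s > 0" using assms by simp
  have sm: "summable (\<lambda>n. 1 / real n powr (3/2))" by (rule summable_inverse_powr) simp
  have "norm (suminf ?t) \<le> (\<Sum>k. norm (?t k))"
    by (rule summable_norm[OF summable_term[OF s]])
  also have "\<dots> \<le> (\<Sum>k. B * norm s * (1 / real k powr (3/2)))"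
  proof (rule suminf_le[OF _ summable_term[OF s] summable_mult[OF sm]])
    fix k
    have "norm (?t k) \<le> B * norm s * (1 / real k powr (Re s + 1))" by (rule norm_term_le[OF s])
    also have "\<dots> \<le> B * norm s * (1 / real k powr (3/2))"
      using assms B_nonneg by (intro mult_left_mono inverse_powr_mono) auto
    finally show "norm (?t k) \<le> B * norm s * (1 / real k powr (3/2))" .
  qed
  also have "\<dots> = B * norm s * (\<Sum>n. 1 / real n powr (3/2))"
    by (rule suminf_mult[OF sm])
  finally show ?thesis by (simp add: dirichlet_L_bounded_partial_sums[OF s])
qed

end

section \<open>Truncated Taylor expansions\<close>

lemma powser_coeffs_unique:
  fixes c d :: "nat \<Rightarrow> complex"
  assumes "r > 0" "\<And>u. norm u < r \<Longrightarrow> (\<lambda>k. c k * u ^ k) sums F u"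
    "\<And>u. norm u < r \<Longrightarrow> (\<lambda>k. d k * u ^ k) sums F u"
  shows "c = d"
proof -
  have ev: "\<forall>\<^sub>F u in nhds 0. norm u < r" for u :: complex
    using assms(1) eventually_nhds_metric by (force simp: dist_norm)
  have "F has_fps_expansion Abs_fps c" "F has_fps_expansion Abs_fps d"
    using ev assms by (auto intro!: has_fps_expansionI elim!: eventually_mono)
  hence "fps_nth (Abs_fps c) k = fps_nth (Abs_fps d) k" for k
    using fps_nth_fps_expansion by metis
  thus ?thesis by auto
qed

lemma sum_exp_le:
  fixes a :: real
  assumes "a \<ge> 0" "finite A" shows "(\<Sum>k\<in>A. a ^ k / fact k) \<le> exp a"
proof -
  have "(\<lambda>k. a ^ k / fact k) sums exp a"
    using exp_converges[of a] by (simp add: divide_inverse mult.commute)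
  hence "summable (\<lambda>k. a ^ k / fact k)" "(\<Sum>k. a ^ k / fact k) = exp a" by (simp_all add: sums_iff)
  thus ?thesis using sum_le_suminf[of "\<lambda>k. a ^ k / fact k" A] assms by simp
qed

text \<open>For \<open>n > 0\<close> this is the probability that a Poisson variable with mean \<open>r ln n\<close> is at most \<open>K\<close>.\<close>

definition poisson_weight :: "real \<Rightarrow> nat \<Rightarrow> nat \<Rightarrow> real" where
  "poisson_weight r K n = (\<Sum>k\<le>K. (r * ln (real n)) ^ k / fact k) / real n powr r"

lemma poisson_weight_bounds:
  assumes "r > 0" shows "0 \<le> poisson_weight r K n" "poisson_weight r K n \<le> 1"
proof -
  have "0 \<le> poisson_weight r K n \<and> poisson_weight r K n \<le> 1"
  proof (cases "n = 0")
    case False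
    hence ln: "ln (real n) \<ge> 0" by simp
    have "(\<Sum>k\<le>K. (r * ln (real n)) ^ k / fact k) \<le> exp (r * ln (real n))"
      using assms ln by (intro sum_exp_le) auto
    also have "\<dots> = real n powr r" using False by (simp add: powr_def)
    finally have "(\<Sum>k\<le>K. (r * ln (real n)) ^ k / fact k) \<le> real n powr r" .
    moreover have "0 \<le> (\<Sum>k\<le>K. (r * ln (real n)) ^ k / fact k)"
      using assms ln by (intro sum_nonneg) auto
    ultimately show ?thesis using False by (auto simp: poisson_weight_def field_simps)
  qed (auto simp: poisson_weight_def)
  thus "0 \<le> poisson_weight r K n" "poisson_weight r K n \<le> 1" by auto
qed

lemma poisson_weight_tendsto:
  assumes "n > 0" shows "(\<lambda>K. poisson_weight r K n) \<longlonglongrightarrow> 1"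
proof -
  have "(\<lambda>k. (r * ln (real n)) ^ k / fact k) sums exp (r * ln (real n))"
    using exp_converges[of "r * ln (real n)"] by (simp add: divide_inverse mult.commute)
  hence "(\<lambda>K. \<Sum>k\<le>K. (r * ln (real n)) ^ k / fact k) \<longlonglongrightarrow> real n powr r"
    using assms by (simp add: sums_def_le powr_def)
  hence "(\<lambda>K. (\<Sum>k\<le>K. (r * ln (real n)) ^ k / fact k) / real n powr r) \<longlonglongrightarrow> real n powr r / real n powr r"
    using assms by (intro tendsto_intros) auto
  thus ?thesis using assms by (simp add: poisson_weight_def)
qed

lemma of_nat_powr_add_of_real:
  "n > 0 \<Longrightarrow> (of_nat n :: complex) powr (1 + of_real r + u) =
     of_nat n * of_real (real n powr r) * exp (of_real (ln (real n)) * u)"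
  by (simp add: powr_def exp_add ring_distribs exp_of_real exp_of_real[symmetric, of "r * ln (real n)"] Ln_of_nat mult.commute)

text \<open>Expand n^(-u) = exp (- u ln n) and exchange the two sums. Summing absolute values over k
  first turns n^(-1-r) into n^(-(1+r-|u|)), which is summable over n because |u| < r. The
  coefficients are written with \<open>infsum\<close> since the exchange is a statement about
  unordered sums.\<close>

lemma dirichlet_powser:
  fixes x :: "nat \<Rightarrow> complex"
  assumes x: "\<And>n. norm (x n) \<le> 1" and u: "norm u < r"
  shows "(\<lambda>k. (\<Sum>\<^sub>\<infinity>n. x n / of_nat n powr (1 + of_real r) * of_real ((- ln (real n)) ^ k / fact k)) * u ^ k)
     sums (\<Sum>n. x n / of_nat n powr (1 + of_real r + u))"
proof -
  define g where "g = (\<lambda>n k. x n / of_nat n powr (1 + of_real r) * ((of_real (- ln (real n)) * u) ^ k / fact k))"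
  have expo: "((\<lambda>k. w ^ k / fact k) has_sum exp w) UNIV" for w :: complex
    using exp_converges[of w] summable_norm_exp[of w]
    by (intro norm_summable_imp_has_sum)
       (auto simp: scaleR_conv_of_real divide_inverse mult.commute norm_mult norm_inverse norm_power)
  have expr: "((\<lambda>k. w ^ k / fact k) has_sum exp w) UNIV" if "w \<ge> 0" for w :: real
    using exp_converges[of w] summable_norm_exp[of w] that
    by (intro norm_summable_imp_has_sum)
       (auto simp: divide_inverse mult.commute norm_mult norm_inverse norm_power)
  have inner: "(g n has_sum (x n / of_nat n powr (1 + of_real r + u))) UNIV" for n
  proof (cases "n = 0")
    case False
    have "(g n has_sum (x n / of_nat n powr (1 + of_real r) * exp (of_real (- ln (real n)) * u))) UNIV"
      unfolding g_def by (rule has_sum_cmult_right[OF expo])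
    also have "x n / of_nat n powr (1 + of_real r) * exp (of_real (- ln (real n)) * u) =
       x n / of_nat n powr (1 + of_real r + u)"
      using of_nat_powr_add_of_real[of n r 0] of_nat_powr_add_of_real[of n r u] False
      by (simp add: exp_minus field_simps)
    finally show ?thesis .
  qed (simp add: g_def)
  have innern: "((\<lambda>k. norm (g n k)) has_sum (norm (x n) / real n powr (1 + r - norm u))) UNIV" for n
  proof (cases "n = 0")
    case False
    have "((\<lambda>k. norm (x n) / real n powr (1 + r) * ((ln (real n) * norm u) ^ k / fact k)) has_sum
       (norm (x n) / real n powr (1 + r) * exp (ln (real n) * norm u))) UNIV"
      using False by (intro has_sum_cmult_right expr) auto
    also have "norm (x n) / real n powr (1 + r) * exp (ln (real n) * norm u) =
        norm (x n) / real n powr (1 + r - norm u)"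
      using False by (simp add: powr_diff powr_def[of _ "norm u"] mult.commute)
    also have "(\<lambda>k. norm (x n) / real n powr (1 + r) * ((ln (real n) * norm u) ^ k / fact k)) = (\<lambda>k. norm (g n k))"
      using False by (auto simp: g_def norm_mult norm_divide norm_power norm_of_nat_powr power_mult_distrib)
    finally show ?thesis .
  qed (simp add: g_def)
  have "summable (\<lambda>n. norm (x n) / real n powr (1 + r - norm u))"
    using summable_dirichlet[of x "of_real (1 + r - norm u)"] x u by (simp add: norm_divide_nat_powr)
  hence "(\<lambda>n. norm (x n) / real n powr (1 + r - norm u)) summable_on UNIV"
    by (subst summable_on_UNIV_nonneg_real_iff) auto
  hence "(\<lambda>z. norm (case z of (n, k) \<Rightarrow> g n k)) summable_on (UNIV \<times> UNIV)"
    using innern by (subst Infinite_Sum.abs_summable_on_Sigma_iff)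
      (auto simp: infsumI[OF innern] intro: has_sum_imp_summable)
  hence sm: "(\<lambda>(n, k). g n k) summable_on (UNIV \<times> UNIV)"
    using Infinite_Sum.abs_summable_summable by blast
  have sm': "(\<lambda>(k, n). g n k) summable_on (UNIV \<times> UNIV)"
    using summable_on_swap[of "\<lambda>(n, k). g n k" UNIV UNIV] sm by (simp add: case_prod_unfold)
  have "(\<lambda>k. \<Sum>\<^sub>\<infinity>n. g n k) summable_on UNIV"
    by (rule summable_on_Sigma_banach[OF sm'])
  hence "((\<lambda>k. \<Sum>\<^sub>\<infinity>n. g n k) has_sum (\<Sum>\<^sub>\<infinity>k. \<Sum>\<^sub>\<infinity>n. g n k)) UNIV" by simp
  also have "(\<Sum>\<^sub>\<infinity>k. \<Sum>\<^sub>\<infinity>n. g n k) = (\<Sum>\<^sub>\<infinity>n. \<Sum>\<^sub>\<infinity>k. g n k)"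
    by (rule infsum_swap_banach[OF sm'])
  also have "\<dots> = (\<Sum>\<^sub>\<infinity>n. x n / of_nat n powr (1 + of_real r + u))"
    by (intro infsum_cong infsumI inner)
  also have "\<dots> = (\<Sum>n. x n / of_nat n powr (1 + of_real r + u))"
  proof -
    have "Re u > - r" using u abs_Re_le_cmod[of u] by linarith
    hence s: "summable (\<lambda>n. norm (x n / of_nat n powr (1 + of_real r + u)))"
      by (intro summable_dirichlet x) auto
    thus ?thesis
      by (intro infsumI norm_summable_imp_has_sum) (auto simp: summable_sums summable_norm_cancel)
  qed
  finally have "(\<lambda>k. \<Sum>\<^sub>\<infinity>n. g n k) sums (\<Sum>n. x n / of_nat n powr (1 + of_real r + u))"
    by (rule has_sum_imp_sums)
  moreover have "(\<Sum>\<^sub>\<infinity>n. g n k) =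
     (\<Sum>\<^sub>\<infinity>n. x n / of_nat n powr (1 + of_real r) * of_real ((- ln (real n)) ^ k / fact k)) * u ^ k" for k
    unfolding g_def power_mult_distrib by (subst infsum_cmult_left'[symmetric]) (simp add: mult.assoc)
  ultimately show ?thesis by simp
qed

text \<open>Half of the spare exponent \<open>r\<close> absorbs the logarithms: with t = r/2, the
  quantity (t ln n)^k / k! is a single term of the exponential series for n^t.\<close>

lemma summable_dirichlet_ln_power:
  fixes x :: "nat \<Rightarrow> complex"
  assumes x: "\<And>n. norm (x n) \<le> 1" and r: "r > 0"
  shows "summable (\<lambda>n. norm (x n / of_nat n powr (1 + of_real r) * of_real ((- ln (real n)) ^ k / fact k)))"
proof (rule summable_comparison_test')
  show "summable (\<lambda>n. (1 / (r / 2) ^ k) * (1 / real n powr (1 + r / 2)))"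
    using r by (intro summable_mult summable_inverse_powr) auto
  fix n :: nat
  show "norm (norm (x n / of_nat n powr (1 + of_real r) * of_real ((- ln (real n)) ^ k / fact k)))
    \<le> (1 / (r / 2) ^ k) * (1 / real n powr (1 + r / 2))"
  proof (cases "n = 0")
    case False
    hence ln: "ln (real n) \<ge> 0" by simp
    define t where "t = r / 2"
    have t: "t > 0" using r by (simp add: t_def)
    have "(t * ln (real n)) ^ k / fact k = (\<Sum>j\<in>{k}. (t * ln (real n)) ^ j / fact j)" by simp
    also have "\<dots> \<le> exp (t * ln (real n))"
      using t ln by (intro sum_exp_le) auto
    also have "\<dots> = real n powr t" using False by (simp add: powr_def)
    finally have *: "(t * ln (real n)) ^ k / fact k \<le> real n powr t" .
    hence *: "ln (real n) ^ k / fact k \<le> (1 / t ^ k) * real n powr t"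
      using t by (simp add: field_simps power_mult_distrib)
    have "norm (norm (x n / of_nat n powr (1 + of_real r) * of_real ((- ln (real n)) ^ k / fact k)))
       = norm (x n) * (1 / real n powr (1 + r)) * (ln (real n) ^ k / fact k)"
      using ln by (simp add: norm_mult norm_divide norm_power norm_of_nat_powr)
    also have "\<dots> \<le> 1 * (1 / real n powr (1 + r)) * ((1 / t ^ k) * real n powr t)"
      using x ln t by (intro mult_mono *) auto
    also have "\<dots> = (1 / t ^ k) * (1 / real n powr (1 + t))"
    proof -
      have "real n powr (1 + r) = real n powr (1 + t) * real n powr t"
        by (simp add: t_def powr_add[symmetric] add.commute)
      thus ?thesis using False by simp
    qed
    finally show ?thesis by (simp add: t_def)
  qed auto
qed

text \<open>Truncating the Taylor series at \<open>1 + r\<close>, evaluated at \<open>1\<close>, smooths the Dirichlet series at \<open>1\<close>.\<close>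

lemma taylor_truncation_eq_weighted_sum:
  fixes x :: "nat \<Rightarrow> complex"
  assumes x: "\<And>n. norm (x n) \<le> 1" and r: "r > 0"
    and c: "\<And>u. norm u < r \<Longrightarrow> (\<lambda>k. c k * u ^ k) sums (\<Sum>n. x n / of_nat n powr (1 + of_real r + u))"
  shows "(\<lambda>n. x n / of_nat n * of_real (poisson_weight r K n)) sums (\<Sum>k\<le>K. c k * (- of_real r) ^ k)"
    and "summable (\<lambda>n. norm (x n / of_nat n * of_real (poisson_weight r K n)))"
proof -
  let ?h = "\<lambda>k n. x n / of_nat n powr (1 + of_real r) * of_real ((- ln (real n)) ^ k / fact k)"
  note sm = summable_dirichlet_ln_power[of x, OF x r]
  \<comment> \<open>Uniqueness of the expansion allows \<open>c\<close> to come from elsewhere,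
    namely from the Taylor series of a holomorphic logarithm, while its values are computed here
    from the Dirichlet series.\<close>
  have cd: "c = (\<lambda>k. \<Sum>\<^sub>\<infinity>n. ?h k n)"
    by (rule powser_coeffs_unique[OF r c dirichlet_powser[OF x]])
  have hs: "?h k sums c k" for k
    unfolding cd by (intro has_sum_imp_sums has_sum_infsum norm_summable_imp_summable_on sm)
  \<comment> \<open>Evaluation at u = -r, that is at s = 1, makes the two signs cancel, so the
    weights are nonnegative. This point is on the boundary of the disc |u| < r, hence only finite
    Taylor sums are used.\<close>
  have eq: "(\<Sum>k\<le>K. ?h k n * (- of_real r) ^ k) = x n / of_nat n * of_real (poisson_weight r K n)" for n
  proof (cases "n = 0")
    case False
    have "(\<Sum>k\<le>K. ?h k n * (- of_real r) ^ k) =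
      x n / of_nat n powr (1 + of_real r) * (\<Sum>k\<le>K. of_real ((- ln (real n)) ^ k / fact k) * (- of_real r) ^ k)"
      by (simp add: sum_distrib_left mult.assoc)
    also have "(\<Sum>k\<le>K. of_real ((- ln (real n)) ^ k / fact k) * (- of_real r :: complex) ^ k) =
       of_real (\<Sum>k\<le>K. (- ln (real n)) ^ k / fact k * (- r) ^ k)" by simp
    also have "(\<Sum>k\<le>K. (- ln (real n)) ^ k / fact k * (- r) ^ k) = (\<Sum>k\<le>K. (r * ln (real n)) ^ k / fact k)"
      by (intro sum.cong refl) (simp add: power_mult_distrib power_minus[of r] power_minus[of "ln (real n)"])
    finally show ?thesis
      using of_nat_powr_add_of_real[of n r 0] False by (simp only: poisson_weight_def) simp
  qed auto
  have "(\<lambda>n. \<Sum>k\<le>K. ?h k n * (- of_real r) ^ k) sums (\<Sum>k\<le>K. c k * (- of_real r) ^ k)"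
    by (intro sums_sum sums_mult2 hs)
  thus "(\<lambda>n. x n / of_nat n * of_real (poisson_weight r K n)) sums (\<Sum>k\<le>K. c k * (- of_real r) ^ k)"
    by (simp only: eq)
  have "summable (\<lambda>n. \<Sum>k\<le>K. norm (?h k n) * norm ((- of_real r :: complex) ^ k))"
    by (intro summable_sum summable_mult2 sm)
  hence "summable (\<lambda>n. norm (\<Sum>k\<le>K. ?h k n * (- of_real r) ^ k))"
    by (rule summable_comparison_test'[where N = 0])
       (simp only: norm_mult[symmetric] real_norm_def abs_norm_cancel norm_sum)
  thus "summable (\<lambda>n. norm (x n / of_nat n * of_real (poisson_weight r K n)))"
    by (simp only: eq)
qed

text \<open>Schwarz's lemma after rescaling to the unit disc: with D = A - Re (g z0), the Moebius
  map v -> v / (2 D - v) takes the half-plane Re v < D into the unit disc and fixes 0.\<close>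

lemma borel_caratheodory:
  fixes g :: "complex \<Rightarrow> complex"
  assumes hol: "g holomorphic_on ball z0 R" and R: "0 < R'" "R' < R"
    and Re: "\<And>z. z \<in> ball z0 R \<Longrightarrow> Re (g z) < A"
    and z: "norm (z - z0) \<le> R'"
  shows "norm (g z) \<le> 2 * R' / (R - R') * (A - Re (g z0)) + norm (g z0)"
proof -
  define D where "D = A - Re (g z0)"
  define G where "G = (\<lambda>w. g (z0 + of_real R * w) - g z0)"
  have R0: "R > 0" using R by simp
  have D: "D > 0" using Re[of z0] R0 by (simp add: D_def)
  have inb: "z0 + of_real R * w \<in> ball z0 R" if "norm w < 1" for w
    using that R0 by (simp add: dist_norm norm_mult)
  have ReG: "Re (G w) < D" if "norm w < 1" for w
    using Re[OF inb[OF that]] by (simp add: G_def D_def)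
  have nz: "2 * of_real D - G w \<noteq> 0" if "norm w < 1" for w
  proof
    assume "2 * of_real D - G w = 0"
    hence "Re (2 * of_real D - G w) = 0" by simp
    thus False using ReG[OF that] D by simp
  qed
  have lt: "norm (G w) < norm (2 * of_real D - G w)" if "norm w < 1" for w
  proof -
    have "norm (2 * of_real D - G w)^2 - norm (G w)^2 = 4 * D * (D - Re (G w))"
      unfolding cmod_power2 by (simp add: power2_eq_square algebra_simps)
    moreover have "\<dots> > 0" using D ReG[OF that] by simp
    ultimately show ?thesis using power2_less_imp_less[of "norm (G w)" "norm (2 * of_real D - G w)"] by simp
  qed
  have holG: "G holomorphic_on ball 0 1"
  proof -
    have "(g \<circ> (\<lambda>w. z0 + of_real R * w)) holomorphic_on ball 0 1"
      by (rule holomorphic_on_compose_gen[OF _ hol]) (use inb in \<open>auto intro!: holomorphic_intros\<close>)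
    thus ?thesis unfolding G_def by (intro holomorphic_intros) (simp add: o_def)
  qed
  define w where "w = (z - z0) / of_real R"
  have w: "norm w \<le> R' / R" using z R0 by (simp add: w_def norm_divide divide_right_mono)
  have "R' / R < 1" using R by simp
  hence w1: "norm w < 1" using w by linarith
  have "norm (G w / (2 * of_real D - G w)) \<le> norm w"
  proof (rule Schwarz_Lemma(1)[OF _ _ _ w1])
    show "(\<lambda>w. G w / (2 * of_real D - G w)) holomorphic_on ball 0 1"
      using nz by (intro holomorphic_intros holG) auto
    show "norm (G w / (2 * of_real D - G w)) < 1" if "norm w < 1" for w
      using lt[OF that] nz[OF that] by (simp add: norm_divide divide_simps)
  qed (simp add: G_def)
  hence "norm (G w) \<le> norm w * norm (2 * of_real D - G w)"
    using nz[OF w1] by (simp add: norm_divide field_simps)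
  also have "\<dots> \<le> (R' / R) * (2 * D + norm (G w))"
    using w D R norm_triangle_ineq4[of "2 * of_real D" "G w"] by (intro mult_mono) (auto simp: norm_mult)
  finally have "norm (G w) * (R - R') \<le> 2 * R' * D"
    using R0 by (simp add: field_simps)
  hence "norm (G w) \<le> 2 * R' / (R - R') * D"
    using R by (simp add: field_simps)
  moreover have "g z = G w + g z0" using R0 by (simp add: G_def w_def)
  ultimately show ?thesis using norm_triangle_ineq[of "G w" "g z0"] by (simp add: D_def)
qed

text \<open>Cauchy's inequality on radius \<open>R'\<close> bounds the k-th term at \<open>w\<close>
  by B (r / R')^k, so the tail is geometric. The first omitted term has index K + 1; replacing that
  exponent by K only weakens the bound by a constant factor.\<close>

lemma taylor_truncation_error:
  fixes g :: "complex \<Rightarrow> complex"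
  assumes hol: "g holomorphic_on ball z0 R" and R: "0 < R'" "R' < R" and r: "norm (w - z0) = r" "r < R'"
    and bound: "\<And>z. norm (z - z0) \<le> R' \<Longrightarrow> norm (g z) \<le> B"
  shows "norm (g w - (\<Sum>k\<le>K. (deriv ^^ k) g z0 / fact k * (w - z0) ^ k)) \<le> B * (r / R') ^ K / (1 - r / R')"
proof -
  let ?c = "\<lambda>k. (deriv ^^ k) g z0 / fact k * (w - z0) ^ k"
  define \<rho> where "\<rho> = r / R'"
  have rho: "0 \<le> \<rho>" "\<rho> < 1" using r R by (auto simp: \<rho>_def)
  have B0: "B \<ge> 0" using bound[of z0] R norm_ge_zero[of "g z0"] by (smt (verit) diff_self norm_zero)
  have cb: "norm (?c k) \<le> B * \<rho> ^ k" for k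
  proof -
    have "norm ((deriv ^^ k) g z0) \<le> fact k * B / R' ^ k"
    proof (rule Cauchy_inequality)
      show "g holomorphic_on ball z0 R'" using hol by (rule holomorphic_on_subset) (use R in auto)
      show "continuous_on (cball z0 R') g"
        by (rule continuous_on_subset[OF holomorphic_on_imp_continuous_on[OF hol]]) (use R in auto)
    qed (use R bound in \<open>auto simp: norm_minus_commute\<close>)
    hence "norm ((deriv ^^ k) g z0) / fact k * r ^ k \<le> (fact k * B / R' ^ k) / fact k * r ^ k"
      using r by (intro mult_right_mono divide_right_mono) auto
    thus ?thesis using r by (simp add: norm_mult norm_divide norm_power \<rho>_def power_divide)
  qed
  have sums: "?c sums g w"
    by (rule holomorphic_power_series[OF hol]) (use r R in \<open>simp add: dist_norm norm_minus_commute\<close>)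
  have "(\<lambda>k. ?c (k + Suc K)) sums (g w - (\<Sum>k<Suc K. ?c k))"
    by (rule sums_split_initial_segment[OF sums])
  hence "(\<lambda>k. ?c (k + Suc K)) sums (g w - (\<Sum>k\<le>K. ?c k))" by (simp only: lessThan_Suc_atMost)
  hence "norm (g w - (\<Sum>k\<le>K. ?c k)) = norm (\<Sum>k. ?c (k + Suc K))" by (simp add: sums_iff)
  also have "\<dots> \<le> (\<Sum>k. B * \<rho> ^ Suc K * \<rho> ^ k)"
  proof (rule norm_suminf_le)
    show "norm (?c (k + Suc K)) \<le> B * \<rho> ^ Suc K * \<rho> ^ k" for k
      using cb[of "k + Suc K"] by (simp add: power_add mult_ac)
    show "summable (\<lambda>k. B * \<rho> ^ Suc K * \<rho> ^ k)"
      using rho by (intro summable_mult summable_geometric) auto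
  qed
  also have "\<dots> = B * \<rho> ^ Suc K / (1 - \<rho>)"
    using rho by (subst suminf_mult) (auto simp: suminf_geometric summable_geometric)
  also have "\<dots> \<le> B * \<rho> ^ K / (1 - \<rho>)"
    using rho B0 by (intro divide_right_mono mult_left_mono power_decreasing) auto
  finally show ?thesis by (simp add: \<rho>_def)
qed

text \<open>Two continuous logarithms of one function differ by values spaced 2 pi apart, hence by a
  constant on a connected set. Of that constant only \<open>exp c = 1\<close> is recorded, which
  already gives Re c = 0.\<close>

lemma exp_eq_imp_differ_by_constant:
  fixes f g :: "complex \<Rightarrow> complex"
  assumes "connected S" "continuous_on S f" "continuous_on S g" "\<And>z. z \<in> S \<Longrightarrow> exp (g z) = exp (f z)"
  obtains c where "exp c = 1" "\<And>z. z \<in> S \<Longrightarrow> g z = f z + c"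
proof (cases "S = {}")
  case False
  have e1: "exp (g z - f z) = 1" if "z \<in> S" for z using assms(4)[OF that] by (simp add: exp_diff)
  have "(\<lambda>z. g z - f z) constant_on S"
  proof (rule continuous_discrete_range_constant[OF assms(1)])
    show "continuous_on S (\<lambda>z. g z - f z)" by (intro continuous_intros assms)
    fix x assume x: "x \<in> S"
    show "\<exists>e>0. \<forall>y. y \<in> S \<and> g y - f y \<noteq> g x - f x \<longrightarrow> e \<le> norm (g y - f y - (g x - f x))"
    proof (intro exI[of _ "2 * pi"] conjI allI impI)
      fix y assume y: "y \<in> S \<and> g y - f y \<noteq> g x - f x"
      show "2 * pi \<le> norm (g y - f y - (g x - f x))"
      proof (rule ccontr)
        assume "\<not> ?thesis"
        hence "\<bar>Im (g y - f y) - Im (g x - f x)\<bar> < 2 * pi"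
          using abs_Im_le_cmod[of "g y - f y - (g x - f x)"] by simp
        moreover have "exp (g y - f y) = exp (g x - f x)" using e1 x y by auto
        ultimately have "g y - f y = g x - f x" by (rule exp_complex_eqI)
        thus False using y by blast
      qed
    qed auto
  qed
  then obtain c where c: "\<And>z. z \<in> S \<Longrightarrow> g z - f z = c" by (auto simp: constant_on_def)
  obtain z1 where "z1 \<in> S" using False by blast
  hence "exp c = 1" using e1[of z1] c[of z1] by simp
  moreover have "g z = f z + c" if "z \<in> S" for z using c[OF that] by (simp add: algebra_simps)
  ultimately show ?thesis by (rule that)
qed (use that[of 0] in auto)

section \<open>Euler products and Dirichlet characters\<close>

text \<open>Sieve of Eratosthenes. Among the integers surviving \<open>P\<close>, those divisible by
  a new prime p are exactly p times the survivors, so by multiplicativity they carry b p times the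
  whole sum.\<close>

lemma infsum_mult_sieve:
  fixes b :: "nat \<Rightarrow> complex"
  assumes mult: "\<And>m n. b (m * n) = b m * b n" and sm: "b summable_on UNIV"
    and P: "finite P" "\<And>p. p \<in> P \<Longrightarrow> prime p"
  shows "infsum b {n. n > 0 \<and> (\<forall>p\<in>P. \<not> p dvd n)} = infsum b {0<..} * (\<Prod>p\<in>P. 1 - b p)"
  using P
proof (induction P rule: finite_induct)
  case empty
  thus ?case by (simp add: greaterThan_def)
next
  case (insert p P)
  define A where "A = {n. n > 0 \<and> (\<forall>p\<in>P. \<not> p dvd n)}"
  have pp: "prime p" using insert by auto
  have Ap: "{n\<in>A. p dvd n} = (\<lambda>m. p * m) ` A"
  proof (intro equalityI subsetI)
    fix n assume n: "n \<in> {n\<in>A. p dvd n}"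
    then obtain m where m: "n = p * m" by auto
    hence "m \<in> A" using n by (auto simp: A_def)
    thus "n \<in> (\<lambda>m. p * m) ` A" using m by blast
  next
    fix n assume "n \<in> (\<lambda>m. p * m) ` A"
    then obtain m where m: "m \<in> A" "n = p * m" by blast
    have "\<not> q dvd p * m" if "q \<in> P" for q
    proof
      assume "q dvd p * m"
      hence "q dvd p \<or> q dvd m" using insert.prems that by (subst (asm) prime_dvd_mult_iff) auto
      moreover have "\<not> q dvd p" using pp insert that primes_dvd_imp_eq by blast
      ultimately show False using m that by (auto simp: A_def)
    qed
    thus "n \<in> {n\<in>A. p dvd n}" using m pp by (auto simp: A_def prime_gt_0_nat)
  qed
  have "infsum b A = infsum b ({n\<in>A. \<not> p dvd n} \<union> {n\<in>A. p dvd n})"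
    by (rule arg_cong[of _ _ "infsum b"]) auto
  also have "\<dots> = infsum b {n\<in>A. \<not> p dvd n} + infsum b {n\<in>A. p dvd n}"
    by (rule infsum_Un_disjoint[OF summable_on_subset_banach[OF sm] summable_on_subset_banach[OF sm]]) auto
  also have "infsum b {n\<in>A. p dvd n} = infsum (\<lambda>m. b (p * m)) A"
    unfolding Ap using pp by (subst infsum_reindex) (auto simp: inj_on_def o_def)
  also have "\<dots> = b p * infsum b A"
    unfolding mult by (rule infsum_cmult_right')
  finally have "infsum b {n\<in>A. \<not> p dvd n} = infsum b A - b p * infsum b A"
    unfolding eq_diff_eq by (rule sym)
  hence "infsum b {n\<in>A. \<not> p dvd n} = infsum b A * (1 - b p)"
    by (simp only: right_diff_distrib mult_1_right mult.commute[of "b p"])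
  also have "{n\<in>A. \<not> p dvd n} = {n. n > 0 \<and> (\<forall>p\<in>insert p P. \<not> p dvd n)}"
    by (auto simp: A_def)
  finally show ?case using insert by (simp add: A_def mult_ac)
qed

text \<open>After sieving by all primes up to N there remain 1 and the integers whose prime factors
  all exceed N; by dominated convergence their sum tends to b 1. Keeping the product next to the
  sum, instead of dividing, avoids any assumption that the factors are nonzero.\<close>

lemma euler_product_tendsto:
  fixes b :: "nat \<Rightarrow> complex"
  assumes mult: "\<And>m n. b (m * n) = b m * b n" and b0: "b 0 = 0" and b1: "b 1 = 1"
    and sm: "summable (\<lambda>n. norm (b n))"
  shows "(\<lambda>N. suminf b * (\<Prod>p | prime p \<and> p \<le> N. 1 - b p)) \<longlonglongrightarrow> 1"
proof -
  define S where "S = (\<lambda>N::nat. {n::nat. n > 0 \<and> (\<forall>p\<in>{p. prime p \<and> p \<le> N}. \<not> p dvd n)})"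
  have sm': "b summable_on UNIV" by (rule norm_summable_imp_summable_on[OF sm])
  have tot: "suminf b = infsum b {0<..}"
  proof -
    have "(b has_sum suminf b) UNIV"
      using sm by (intro norm_summable_imp_has_sum) (auto intro: summable_sums summable_norm_cancel)
    hence "infsum b UNIV = suminf b" by (rule infsumI)
    also have "infsum b UNIV = infsum b {0<..}"
      by (rule infsum_cong_neutral) (auto simp: b0)
    finally show ?thesis by simp
  qed
  have eq: "suminf b * (\<Prod>p | prime p \<and> p \<le> N. 1 - b p) = (\<Sum>n. if n \<in> S N then b n else 0)" for N
  proof -
    have "infsum b (S N) = suminf b * (\<Prod>p | prime p \<and> p \<le> N. 1 - b p)"
      unfolding S_def tot by (rule infsum_mult_sieve[OF mult sm']) auto
    moreover have "infsum b (S N) = infsum (\<lambda>n. if n \<in> S N then b n else 0) UNIV"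
      by (rule infsum_cong_neutral) auto
    moreover have sn: "summable (\<lambda>n. norm (if n \<in> S N then b n else 0))"
      by (rule summable_comparison_test'[OF sm, of 0]) auto
    have "((\<lambda>n. if n \<in> S N then b n else 0) has_sum (\<Sum>n. if n \<in> S N then b n else 0)) UNIV"
      by (intro norm_summable_imp_has_sum sn) (intro summable_sums summable_norm_cancel[OF sn])
    hence "infsum (\<lambda>n. if n \<in> S N then b n else 0) UNIV = (\<Sum>n. if n \<in> S N then b n else 0)"
      by (rule infsumI)
    ultimately show ?thesis by simp
  qed
  have "(\<lambda>N. \<Sum>n. if n \<in> S N then b n else 0) \<longlonglongrightarrow> (\<Sum>n. if n = 1 then b n else 0)"
  proof -
    have lim: "(\<lambda>N. if n \<in> S N then b n else 0) \<longlonglongrightarrow> (if n = 1 then b n else 0)" for n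
    proof (cases "n \<le> 1")
      case True
      hence "(if n \<in> S N then b n else 0) = (if n = 1 then b n else 0)" for N
        by (cases n) (auto simp: S_def b0)
      thus ?thesis by simp
    next
      case False
      then obtain p where p: "prime p" "p dvd n" using prime_factor_nat[of n] by auto
      have "\<forall>\<^sub>F N in sequentially. (if n \<in> S N then b n else 0) = (if n = 1 then b n else 0)"
        using eventually_ge_at_top[of n]
      proof eventually_elim
        case (elim N)
        have "p \<le> n" using p False by (intro dvd_imp_le) auto
        hence "n \<notin> S N" using p elim by (auto simp: S_def)
        thus ?case using False by simp
      qed
      thus ?thesis by (rule tendsto_eventually)
    qed
    show ?thesis
      by (rule suminf_dominated_convergence[OF lim _ sm]) auto
  qed
  also have "(\<Sum>n. if n = 1 then b n else 0) = 1"
    using sums_unique[OF sums_single[of 1 b]] b1 by simp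
  finally show ?thesis by (simp only: eq)
qed

text \<open>For |w| < 1 this is the sum of w^k / k over k >= 2, the share of the higher prime powers
  in the logarithm of an Euler factor.\<close>

definition log_remainder :: "complex \<Rightarrow> complex" where
  "log_remainder w = - Ln (1 - w) - w"

lemma log_remainder_0 [simp]: "log_remainder 0 = 0"
  by (simp add: log_remainder_def)

text \<open>The threshold 3/4 is a convenient number between 2^(-1/2), the largest possible size of
  a term at a prime when Re s >= 1/2, and 1. The factor 4 is 1 / (1 - 3/4).\<close>

lemma norm_log_remainder_le: "norm w \<le> 3/4 \<Longrightarrow> norm (log_remainder w) \<le> 4 * norm w ^ 2"
proof -
  assume w: "norm w \<le> 3/4"
  have "norm (log_remainder w) = norm (Ln (1 + (-w)) - (-w))"
    unfolding log_remainder_def by (subst norm_minus_cancel[symmetric]) (simp add: algebra_simps)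
  also have "\<dots> \<le> norm w ^ 2 / (1 - norm w)" using Ln_approx_linear[of "-w"] w by simp
  also have "\<dots> \<le> norm w ^ 2 / (1/4)" using w by (intro divide_left_mono) auto
  finally show ?thesis by simp
qed

lemma Re_log_remainder: "norm w < 1 \<Longrightarrow> Re (log_remainder w) = - ln (norm (1 - w)) - Re w"
  unfolding log_remainder_def by (subst minus_complex.sel, subst uminus_complex.sel, subst Re_Ln) auto

context
  fixes x :: "nat \<Rightarrow> complex"
  assumes x: "\<And>n. norm (x n) \<le> 1" and x01: "\<And>n. n < 2 \<Longrightarrow> x n = 0"
begin

lemma norm_term_le_half:
  assumes "Re s \<ge> 1/2" shows "norm (x n / of_nat n powr s) \<le> 3/4"
proof (cases "n < 2")
  case False
  have "norm (x n / of_nat n powr s) \<le> 1 / real n powr Re s"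
    unfolding norm_divide_nat_powr using x by (intro divide_right_mono) auto
  also have "\<dots> \<le> 1 / real n powr (1/2)" using assms by (rule inverse_powr_mono)
  also have "\<dots> \<le> 1 / 2 powr (1/2)" using False by (intro divide_left_mono powr_mono2) auto
  also have "\<dots> \<le> 3/4"
  proof -
    have "(4/3::real) \<le> sqrt 2" by (rule real_le_rsqrt) (simp add: power2_eq_square)
    thus ?thesis by (simp add: powr_half_sqrt field_simps)
  qed
  finally show ?thesis .
qed (use x01 in auto)

lemma norm_log_remainder_term_le:
  assumes "Re s \<ge> b" "b \<ge> 1/2"
  shows "norm (log_remainder (x n / of_nat n powr s)) \<le> 4 * (1 / real n powr (2 * b))"
proof -
  have "norm (log_remainder (x n / of_nat n powr s)) \<le> 4 * norm (x n / of_nat n powr s) ^ 2"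
    using assms by (intro norm_log_remainder_le norm_term_le_half) auto
  also have "norm (x n / of_nat n powr s) ^ 2 \<le> (1 / real n powr b) ^ 2"
  proof (rule power_mono)
    have "norm (x n / of_nat n powr s) \<le> 1 / real n powr Re s"
      unfolding norm_divide_nat_powr using x by (intro divide_right_mono) auto
    also have "\<dots> \<le> 1 / real n powr b" using assms by (intro inverse_powr_mono)
    finally show "norm (x n / of_nat n powr s) \<le> 1 / real n powr b" .
  qed auto
  also have "(1 / real n powr b)^2 = 1 / real n powr (2 * b)"
    by (simp add: power2_eq_square powr_add[symmetric])
  finally show ?thesis by simp
qed

lemma summable_log_remainder:
  assumes "Re s > 1/2" shows "summable (\<lambda>n. norm (log_remainder (x n / of_nat n powr s)))"
proof (rule summable_comparison_test')
  show "summable (\<lambda>n. 4 * (1 / real n powr (2 * Re s)))"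
    using assms by (intro summable_mult summable_inverse_powr) auto
  show "norm (norm (log_remainder (x n / of_nat n powr s))) \<le> 4 * (1 / real n powr (2 * Re s))" for n
    using norm_log_remainder_term_le[of "Re s" s n] assms by simp
qed

lemma norm_suminf_log_remainder_le:
  assumes "Re s \<ge> b" "b > 1/2"
  shows "norm (\<Sum>n. log_remainder (x n / of_nat n powr s)) \<le> 4 * (\<Sum>n. 1 / real n powr (2 * b))"
proof -
  have sm: "summable (\<lambda>n. 1 / real n powr (2 * b))" using assms by (intro summable_inverse_powr) auto
  have "norm (\<Sum>n. log_remainder (x n / of_nat n powr s)) \<le> (\<Sum>n. 4 * (1 / real n powr (2 * b)))"
    using assms by (intro norm_suminf_le summable_mult[OF sm] norm_log_remainder_term_le) auto
  thus ?thesis by (simp only: suminf_mult[OF sm])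
qed

lemma holomorphic_log_remainder:
  "(\<lambda>s. \<Sum>n. log_remainder (x n / of_nat n powr s)) holomorphic_on {s. Re s > 1/2}"
proof (rule holomorphic_on_suminf_halfplane)
  fix n
  show "(\<lambda>s. log_remainder (x n / of_nat n powr s)) holomorphic_on {s. Re s > 1/2}"
  proof (cases "n < 2")
    case False
    have "1 - x n / of_nat n powr s \<notin> \<real>\<^sub>\<le>\<^sub>0" if "Re s > 1/2" for s
    proof
      assume "1 - x n / of_nat n powr s \<in> \<real>\<^sub>\<le>\<^sub>0"
      hence "1 \<le> Re (x n / of_nat n powr s)" by (auto simp: complex_nonpos_Reals_iff)
      also have "\<dots> \<le> 3/4" using norm_term_le_half[of s n] that complex_Re_le_cmod order_trans less_imp_le by blast
      finally show False by simp
    qed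
    thus ?thesis unfolding log_remainder_def using False
      by (intro holomorphic_intros) auto
  qed (simp add: x01)
next
  fix b C :: real assume b: "b > 1/2"
  show "\<exists>M. summable M \<and> (\<forall>n s. b \<le> Re s \<longrightarrow> cmod s \<le> C \<longrightarrow> 
      norm (log_remainder (x n / of_nat n powr s)) \<le> M n)"
    using b norm_log_remainder_term_le
    by (intro exI[of _ "\<lambda>n. 4 * (1 / real n powr (2 * b))"] conjI summable_mult summable_inverse_powr) auto
qed

end

text \<open>Padding with zeros makes a sum over primes an ordinary Dirichlet series:
  \<open>dirichlet_L (on_primes c)\<close> is the sum of c(p) p^(-s), and the general lemmas apply
  to it.\<close>

definition on_primes :: "(nat \<Rightarrow> complex) \<Rightarrow> nat \<Rightarrow> complex" where
  "on_primes c n = (if prime n then c n else 0)"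

lemma on_primes_lt_2: "n < 2 \<Longrightarrow> on_primes c n = 0"
  using prime_ge_2_nat[of n] by (auto simp: on_primes_def)

lemma norm_on_primes_le: "(\<And>n. norm (c n) \<le> 1) \<Longrightarrow> norm (on_primes c n) \<le> 1"
  by (simp add: on_primes_def)

definition log_L_remainder :: "(nat \<Rightarrow> complex) \<Rightarrow> complex \<Rightarrow> complex" where
  "log_L_remainder c s = (\<Sum>n. log_remainder (on_primes c n / of_nat n powr s))"

lemma log_L_sums:
  fixes c :: "nat \<Rightarrow> complex"
  assumes c: "\<And>n. norm (c n) \<le> 1" and s: "Re s > 1"
  shows "(\<lambda>n. - Ln (1 - on_primes c n / of_nat n powr s)) sums
           (dirichlet_L (on_primes c) s + log_L_remainder c s)"
proof -
  note op = norm_on_primes_le[of c, OF c] on_primes_lt_2[of _ c]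
  let ?w = "\<lambda>n. on_primes c n / of_nat n powr s"
  have "?w sums dirichlet_L (on_primes c) s"
    unfolding dirichlet_L_def by (rule summable_sums[OF summable_norm_cancel[OF summable_dirichlet[OF op(1) s]]])
  moreover have "(\<lambda>n. log_remainder (?w n)) sums log_L_remainder c s"
    unfolding log_L_remainder_def
    by (rule summable_sums[OF summable_norm_cancel[OF summable_log_remainder[OF op]]]) (use s in auto)
  ultimately have "(\<lambda>n. ?w n + log_remainder (?w n)) sums (dirichlet_L (on_primes c) s + log_L_remainder c s)"
    by (rule sums_add)
  thus ?thesis by (simp add: log_remainder_def)
qed

text \<open>Exponentiating the series of logarithms of Euler factors avoids choosing a branch of log
  L. The partial sums exponentiate to reciprocals of finite Euler products, and multiplying by the
  sieve limit leaves a constant sequence.\<close>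

lemma exp_log_L:
  fixes c :: "nat \<Rightarrow> complex"
  assumes mult: "\<And>m n. c (m * n) = c m * c n" and c1: "c 1 = 1" and c: "\<And>n. norm (c n) \<le> 1"
    and s: "Re s > 1"
  shows "exp (dirichlet_L (on_primes c) s + log_L_remainder c s) = dirichlet_L c s"
proof -
  \<comment> \<open>Here \<open>b 0 = 0\<close> even if \<open>c 0 = 1\<close>, because
    \<open>0 powr s = 0\<close> and division by 0 gives 0. This admits the constant function 1,
    hence zeta.\<close>
  define b where "b = (\<lambda>n. c n / of_nat n powr s)"
  have b_mult: "b (m * n) = b m * b n" for m n
  proof -
    have "(of_nat m * of_nat n :: complex) powr s = of_nat m powr s * of_nat n powr s"
      by (cases "m = 0 \<or> n = 0") (auto simp: powr_times_real[of "of_nat m" "of_nat n"])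
    thus ?thesis by (simp add: b_def mult)
  qed
  note op = norm_on_primes_le[of c, OF c] on_primes_lt_2[of _ c]
  let ?w = "\<lambda>n. on_primes c n / of_nat n powr s"
  have w1: "norm (?w n) < 1" for n
    using norm_term_le_half[where x = "on_primes c" and s = s and n = n] op s by simp
  have nz: "1 - ?w n \<noteq> 0" for n using w1[of n] by auto
  have "(\<lambda>n. - Ln (1 - ?w n)) sums (dirichlet_L (on_primes c) s + log_L_remainder c s)"
    by (rule log_L_sums[OF c s])
  hence "(\<lambda>N. exp (\<Sum>n\<le>N. - Ln (1 - ?w n))) \<longlonglongrightarrow> exp (dirichlet_L (on_primes c) s + log_L_remainder c s)"
    unfolding sums_def_le by (rule tendsto_exp)
  also have "(\<lambda>N. exp (\<Sum>n\<le>N. - Ln (1 - ?w n))) = (\<lambda>N. 1 / (\<Prod>p | prime p \<and> p \<le> N. 1 - b p))"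
  proof
    fix N
    have "exp (\<Sum>n\<le>N. - Ln (1 - ?w n)) = (\<Prod>n\<le>N. 1 / (1 - ?w n))"
      using nz by (simp add: exp_sum exp_minus divide_inverse)
    also have "\<dots> = (\<Prod>n | prime n \<and> n \<le> N. 1 / (1 - ?w n))"
      by (rule prod.mono_neutral_right) (auto simp: on_primes_def)
    also have "\<dots> = (\<Prod>p | prime p \<and> p \<le> N. 1 / (1 - b p))"
      by (rule prod.cong) (auto simp: on_primes_def b_def)
    finally show "exp (\<Sum>n\<le>N. - Ln (1 - ?w n)) = 1 / (\<Prod>p | prime p \<and> p \<le> N. 1 - b p)"
      by (simp add: prod_dividef)
  qed
  finally have lim1: "(\<lambda>N. 1 / (\<Prod>p | prime p \<and> p \<le> N. 1 - b p)) \<longlonglongrightarrow>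
      exp (dirichlet_L (on_primes c) s + log_L_remainder c s)" .
  have lim2: "(\<lambda>N. suminf b * (\<Prod>p | prime p \<and> p \<le> N. 1 - b p)) \<longlonglongrightarrow> 1"
  proof (rule euler_product_tendsto[OF b_mult])
    show "summable (\<lambda>n. norm (b n))" unfolding b_def by (intro summable_dirichlet c s)
  qed (use c1 in \<open>auto simp: b_def\<close>)
  have nzp: "(\<Prod>p | prime p \<and> p \<le> N. 1 - b p) \<noteq> 0" for N
  proof -
    have "1 - b p \<noteq> 0" if "prime p" for p using nz[of p] that by (simp add: b_def on_primes_def)
    thus ?thesis by auto
  qed
  have "(\<lambda>N. 1 / (\<Prod>p | prime p \<and> p \<le> N. 1 - b p) * (suminf b * (\<Prod>p | prime p \<and> p \<le> N. 1 - b p)))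
     \<longlonglongrightarrow> exp (dirichlet_L (on_primes c) s + log_L_remainder c s) * 1"
    by (rule tendsto_mult[OF lim1 lim2])
  hence "(\<lambda>N::nat. suminf b) \<longlonglongrightarrow> exp (dirichlet_L (on_primes c) s + log_L_remainder c s)"
    using nzp by simp
  hence "suminf b = exp (dirichlet_L (on_primes c) s + log_L_remainder c s)"
    by (simp add: LIMSEQ_const_iff)
  thus ?thesis by (simp add: b_def dirichlet_L_def)
qed

section \<open>Elementary properties of Dirichlet characters\<close>

lemma dirichlet_char_mod:
  assumes "dirichlet_char q chi" shows "chi (n mod q) = chi n"
proof -
  have "chi (m + k * q) = chi m" for m k
  proof (induction k)
    case (Suc k)
    have "chi (m + Suc k * q) = chi ((m + k * q) + q)" by (simp add: algebra_simps)
    also have "\<dots> = chi m" using assms Suc by (simp add: dirichlet_char_def)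
    finally show ?case .
  qed auto
  from this[of "n mod q" "n div q"] show ?thesis by simp
qed

lemma dirichlet_char_cong: "dirichlet_char q chi \<Longrightarrow> [m = n] (mod q) \<Longrightarrow> chi m = chi n"
  by (metis dirichlet_char_mod cong_def)

lemma dirichlet_char_1: "dirichlet_char q chi \<Longrightarrow> chi 1 = 1"
  by (metis dirichlet_char_def coprime_1_left mult_cancel_right1 mult_1)

lemma dirichlet_char_power: "dirichlet_char q chi \<Longrightarrow> chi (n ^ k) = chi n ^ k"
proof (induction k)
  case 0
  thus ?case using dirichlet_char_1[of q chi] by simp
qed (simp add: dirichlet_char_def)

lemma dirichlet_char_power_totient:
  assumes "dirichlet_char q chi" "coprime n q" shows "chi n ^ totient q = 1"
proof -
  have "[n ^ totient q = 1] (mod q)" using assms(2) by (rule euler_theorem)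
  hence "chi (n ^ totient q) = chi 1" by (rule dirichlet_char_cong[OF assms(1)])
  thus ?thesis using dirichlet_char_power[OF assms(1)] dirichlet_char_1[OF assms(1)] by simp
qed

lemma norm_dirichlet_char_le:
  assumes "dirichlet_char q chi" shows "norm (chi n) \<le> 1"
proof (cases "coprime n q")
  case True
  have "totient q > 0" using assms by (simp add: dirichlet_char_def)
  hence "norm (chi n) = 1"
    using dirichlet_char_power_totient[OF assms True] by (metis norm_power norm_one power_eq_1_iff norm_ge_zero gr_implies_not0)
  thus ?thesis by simp
next
  case False
  hence "chi n = 0" using assms unfolding dirichlet_char_def by blast
  thus ?thesis by simp
qed

lemma sum_dirichlet_char_zero:
  assumes chi: "dirichlet_char q chi" and np: "\<not> principal_char q chi"
  shows "(\<Sum>n<q. chi n) = 0"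
proof -
  obtain a where a: "coprime a q" "chi a \<noteq> 1" using np by (auto simp: principal_char_def)
  have q: "q > 0" using chi by (simp add: dirichlet_char_def)
  have inj: "inj_on (\<lambda>n. a * n mod q) {..<q}"
  proof (rule inj_onI)
    fix m n assume mn: "m \<in> {..<q}" "n \<in> {..<q}" "a * m mod q = a * n mod q"
    hence "[a * m = a * n] (mod q)" by (simp add: cong_def)
    hence "[m = n] (mod q)" using a(1) by (simp add: cong_mult_lcancel_nat)
    thus "m = n" using mn by (simp add: cong_def)
  qed
  have "(\<lambda>n. a * n mod q) ` {..<q} \<subseteq> {..<q}" using q by auto
  hence img: "(\<lambda>n. a * n mod q) ` {..<q} = {..<q}"
    by (intro endo_inj_surj inj) auto
  have "(\<Sum>n<q. chi n) = (\<Sum>n\<in>(\<lambda>n. a * n mod q) ` {..<q}. chi n)" by (simp only: img)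
  also have "\<dots> = (\<Sum>n<q. chi (a * n mod q))" by (subst sum.reindex[OF inj]) simp
  also have "\<dots> = (\<Sum>n<q. chi a * chi n)"
    using chi dirichlet_char_mod[OF chi] by (simp add: dirichlet_char_def)
  also have "\<dots> = chi a * (\<Sum>n<q. chi n)" by (simp add: sum_distrib_left)
  finally have "(chi a - 1) * (\<Sum>n<q. chi n) = 0" by (simp add: algebra_simps)
  thus ?thesis using a by simp
qed

text \<open>Complete periods cancel, so fewer than q terms remain. This trivial bound is good enough
  since only its logarithm matters later.\<close>

lemma norm_sum_dirichlet_char_le:
  assumes chi: "dirichlet_char q chi" and np: "\<not> principal_char q chi"
  shows "norm (\<Sum>j\<le>n. chi j) \<le> real q"
proof -
  have q: "q > 0" using chi by (simp add: dirichlet_char_def)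
  have "norm (\<Sum>j<n. chi j) \<le> real q" for n
  proof (induction n rule: less_induct)
    case (less n)
    show ?case
    proof (cases "n < q")
      case True
      have "norm (\<Sum>j<n. chi j) \<le> (\<Sum>j<n. 1)"
        by (intro sum_norm_le norm_dirichlet_char_le[OF chi])
      thus ?thesis using True by simp
    next
      case False
      have "(\<Sum>j<n. chi j) = (\<Sum>j<q. chi j) + (\<Sum>j=q..<n. chi j)"
        using False by (metis atLeast0LessThan linorder_not_less sum.atLeastLessThan_concat zero_le)
      also have "(\<Sum>j=q..<n. chi j) = (\<Sum>j=0+q..<(n-q)+q. chi j)" using False by simp
      also have "\<dots> = (\<Sum>j=0..<n-q. chi (j + q))" by (rule sum.shift_bounds_nat_ivl)
      also have "\<dots> = (\<Sum>j<n-q. chi j)" using chi by (simp add: dirichlet_char_def atLeast0LessThan)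
      finally have "(\<Sum>j<n. chi j) = (\<Sum>j<n-q. chi j)" using sum_dirichlet_char_zero[OF chi np] by simp
      thus ?thesis using less.IH[of "n - q"] q False by simp
    qed
  qed
  from this[of "Suc n"] show ?thesis by (simp add: lessThan_Suc_atMost)
qed

text \<open>Modulus 1 is the exception to rule out: there 0 is coprime to the modulus, but the only
  character is principal.\<close>

lemma dirichlet_char_0:
  assumes "dirichlet_char q chi" "\<not> principal_char q chi" shows "chi 0 = 0"
proof -
  have "q \<noteq> 1"
  proof
    assume "q = 1"
    hence "chi n = 1" for n
      using dirichlet_char_cong[OF assms(1), of n 1] dirichlet_char_1[OF assms(1)] by (simp add: cong_def)
    thus False using assms(2) by (auto simp: principal_char_def)
  qed
  thus ?thesis using assms(1) by (simp add: dirichlet_char_def)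
qed

section \<open>Nonvanishing\<close>

text \<open>The function \<open>(s - 1) \<zeta>(s)\<close>, continued to \<open>Re s > 0\<close>; the term with \<open>n = 0\<close> equals \<open>1\<close>
  since \<open>0 powr z = 0\<close>.\<close>

definition zeta_reg :: "complex \<Rightarrow> complex" where
  "zeta_reg s = (\<Sum>n. (s - 1) / of_nat n powr s - of_nat n powr (1 - s) + of_nat (Suc n) powr (1 - s))"

text \<open>For n > 0 the term is the second-order Taylor remainder of x^(1-s) on the unit step from
  n to n + 1. The second derivative has size |s| |1 - s| x^(-Re s - 1), which gives convergence for
  Re s > 0.\<close>

lemma norm_zeta_reg_term_le:
  assumes "Re s > 0"
  shows "norm ((s - 1) / of_nat n powr s - of_nat n powr (1 - s) + of_nat (Suc n) powr (1 - s))
     \<le> (if n = 0 then 1 else 0) + norm s * norm (1 - s) * (1 / real n powr (Re s + 1))"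
proof (cases "n = 0")
  case False
  hence n: "n > 0" by simp
  define f where "f = (\<lambda>(i::nat) x. if i = 0 then x powr (1 - s) else if i = 1 then (1 - s) * x powr (- s)
       else (1 - s) * ((- s) * x powr (- s - 1)))"
  have "norm (f 0 (of_nat (Suc n)) - (\<Sum>i\<le>1. f i (of_nat n) * (of_nat (Suc n) - of_nat n) ^ i / fact i))
     \<le> (norm s * norm (1 - s) * (1 / real n powr (Re s + 1))) * norm (of_nat (Suc n) - of_nat n :: complex) ^ (Suc 1) / fact 1"
  proof (rule complex_Taylor[OF convex_closed_segment[of "of_nat n" "of_nat (Suc n)"]])
    fix i and z :: complex assume z: "z \<in> closed_segment (of_nat n) (of_nat (Suc n))" and i: "i \<le> (1::nat)"
    have 1: "((\<lambda>x. x powr (1 - s)) has_field_derivative (1 - s) * z powr (- s)) (at z)"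
      using has_field_derivative_powr_segment(1)[OF z n, of "1 - s"] by simp
    have 2: "((\<lambda>x. (1 - s) * x powr (- s)) has_field_derivative (1 - s) * ((- s) * z powr (- s - 1))) (at z)"
      by (rule DERIV_cmult[OF has_field_derivative_powr_segment(1)[OF z n]])
    from i have "i = 0 \<or> i = 1" by auto
    thus "(f i has_field_derivative f (Suc i) z) (at z within closed_segment (of_nat n) (of_nat (Suc n)))"
      using 1 2 by (auto simp: f_def intro: has_field_derivative_at_within)
  next
    fix z :: complex assume z: "z \<in> closed_segment (of_nat n) (of_nat (Suc n))"
    note d = has_field_derivative_powr_segment[OF z n]
    have "Re z powr (- Re s - 1) \<le> real n powr (- Re s - 1)"
      using d(3) assms n by (intro powr_mono2') auto
    also have "\<dots> = 1 / real n powr (Re s + 1)"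
      using powr_minus_divide[of "real n" "Re s + 1"] by simp
    finally have "norm (1 - s) * (norm s * Re z powr (- Re s - 1)) \<le> norm (1 - s) * (norm s * (1 / real n powr (Re s + 1)))"
      by (intro mult_left_mono) auto
    thus "norm (f (Suc 1) z) \<le> norm s * norm (1 - s) * (1 / real n powr (Re s + 1))"
      by (simp add: f_def norm_mult d(2) mult_ac)
  qed auto
  thus ?thesis using False
    by (simp add: f_def powr_minus_divide algebra_simps diff_divide_distrib)
qed auto

lemma holomorphic_zeta_reg: "zeta_reg holomorphic_on {s. Re s > 0}"
  unfolding zeta_reg_def
proof (rule holomorphic_on_suminf_halfplane)
  fix n :: nat
  have "of_nat (Suc n) \<noteq> (0::complex)" by (simp del: of_nat_Suc)
  thus "(\<lambda>s. (s - 1) / of_nat n powr s - of_nat n powr (1 - s) + of_nat (Suc n) powr (1 - s)) holomorphic_on {s. Re s > 0}"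
    by (cases "n = 0") (auto intro!: holomorphic_intros simp del: of_nat_Suc)
next
  fix b C :: real assume b: "b > 0"
  show "\<exists>M. summable M \<and> (\<forall>n s. b \<le> Re s \<longrightarrow> cmod s \<le> C \<longrightarrow>
       norm ((s - 1) / of_nat n powr s - of_nat n powr (1 - s) + of_nat (Suc n) powr (1 - s)) \<le> M n)"
  proof (intro exI[of _ "\<lambda>k. (if k = 0 then 1 else 0) + C * (1 + C) * (1 / real k powr (b + 1))"] conjI allI impI)
    show "summable (\<lambda>k. (if k = 0 then 1 else 0) + C * (1 + C) * (1 / real k powr (b + 1)))"
      using b by (intro summable_add summable_mult summable_inverse_powr summable_single) auto
    fix n s assume s: "b \<le> Re s" "norm s \<le> C"
    have C: "C \<ge> 0" using s norm_ge_zero order_trans by blast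
    have "norm ((s - 1) / of_nat n powr s - of_nat n powr (1 - s) + of_nat (Suc n) powr (1 - s))
     \<le> (if n = 0 then 1 else 0) + norm s * norm (1 - s) * (1 / real n powr (Re s + 1))"
      using s b by (intro norm_zeta_reg_term_le) auto
    also have "norm s * norm (1 - s) * (1 / real n powr (Re s + 1)) \<le> C * (1 + C) * (1 / real n powr (b + 1))"
      using s C norm_triangle_ineq4[of 1 s] by (intro mult_mono inverse_powr_mono) auto
    finally show "norm ((s - 1) / of_nat n powr s - of_nat n powr (1 - s) + of_nat (Suc n) powr (1 - s))
      \<le> (if n = 0 then 1 else 0) + C * (1 + C) * (1 / real n powr (b + 1))" by simp
  qed
qed

text \<open>This value is the residue of zeta at its pole. At s = 1 all terms with n > 0 cancel and
  only index 0 contributes.\<close>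

lemma zeta_reg_1: "zeta_reg 1 = 1"
proof -
  have "zeta_reg 1 = (\<Sum>n. if n = 0 then 1 else 0)"
    unfolding zeta_reg_def by (intro suminf_cong) (auto simp del: of_nat_Suc)
  also have "\<dots> = 1" using sums_unique[OF sums_single[of 0 "\<lambda>_. 1 :: complex"]] by simp
  finally show ?thesis .
qed

lemma zeta_reg_eq:
  assumes s: "Re s > 1" shows "zeta_reg s = (s - 1) * dirichlet_L (\<lambda>_. 1) s"
proof -
  have "(\<lambda>n. 1 / of_nat n powr s) sums dirichlet_L (\<lambda>_. 1) s"
    unfolding dirichlet_L_def
    by (rule summable_sums[OF summable_norm_cancel[OF summable_dirichlet[OF _ s]]]) auto
  hence 1: "(\<lambda>n. (s - 1) * (1 / of_nat n powr s)) sums ((s - 1) * dirichlet_L (\<lambda>_. 1) s)"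
    by (rule sums_mult)
  have "(\<lambda>n. of_nat n powr (1 - s)) \<longlonglongrightarrow> 0"
  proof (rule tendsto_norm_zero_cancel)
    have "(\<lambda>N. real N powr (1 - Re s)) \<longlonglongrightarrow> 0"
      using s by (intro tendsto_neg_powr filterlim_real_sequentially) auto
    thus "(\<lambda>n. norm (of_nat n powr (1 - s) :: complex)) \<longlonglongrightarrow> 0" by (simp add: norm_of_nat_powr)
  qed
  \<comment> \<open>The boundary value at 0 is 0, again by \<open>0 powr z = 0\<close>, so for Re s
    > 1 the telescoping part contributes nothing.\<close>
  hence 2: "(\<lambda>n. of_nat (Suc n) powr (1 - s) - of_nat n powr (1 - s)) sums (0 - of_nat 0 powr (1 - s))"
    by (rule telescope_sums)
  from sums_add[OF 1 2] show ?thesis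
    unfolding zeta_reg_def by (simp add: sums_iff algebra_simps)
qed

lemma exp_log_zeta:
  assumes "Re s > 1"
  shows "exp (dirichlet_L (on_primes (\<lambda>_. 1)) s + log_L_remainder (\<lambda>_. 1) s) = dirichlet_L (\<lambda>_. 1) s"
  by (rule exp_log_L) (use assms in auto)

lemma zeta_reg_nonzero: "Re s > 1 \<Longrightarrow> zeta_reg s \<noteq> 0"
  using exp_log_zeta[of s] exp_not_eq_zero zeta_reg_eq[of s] by (metis mult_eq_0_iff eq_iff_diff_eq_0 less_irrefl one_complex.sel(1))

text \<open>With v = z^n the n-th term of the logarithmic series is y^n / n times 3 + 4 v + v^2, and
  for |v| <= 1 the real part of the last factor is at least 2 (1 + Re v)^2. Allowing |z| < 1 covers
  primes where the character vanishes.\<close>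

lemma three_four_one:
  fixes z :: complex
  assumes y: "0 \<le> y" "y < 1" and z: "norm z \<le> 1"
  shows "Re (3 * (- Ln (1 - of_real y)) + 4 * (- Ln (1 - of_real y * z)) + (- Ln (1 - of_real y * z ^ 2))) \<ge> 0"
proof -
  have ser: "(\<lambda>n. w ^ n / of_nat n) sums (- Ln (1 - w))" if "norm w < 1" for w :: complex
    using sums_minus[OF Ln_series'[of "-w"]] that by simp
  have "norm (z ^ 2) \<le> 1" using z by (simp add: norm_power power_le_one)
  hence w: "norm (of_real y * z) < 1" "norm (of_real y * z ^ 2) < 1"
    using y z mult_left_mono[of "norm z" 1 y] mult_left_mono[of "norm (z ^ 2)" 1 y] by (auto simp: norm_mult)
  have "(\<lambda>n. 3 * ((of_real y) ^ n / of_nat n) + 4 * ((of_real y * z) ^ n / of_nat n) + (of_real y * z ^ 2) ^ n / of_nat n)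
     sums (3 * (- Ln (1 - of_real y)) + 4 * (- Ln (1 - of_real y * z)) + (- Ln (1 - of_real y * z ^ 2)))"
    using y w by (intro sums_add sums_mult ser) auto
  hence S: "(\<lambda>n. Re (3 * ((of_real y) ^ n / of_nat n) + 4 * ((of_real y * z) ^ n / of_nat n) + (of_real y * z ^ 2) ^ n / of_nat n))
     sums Re (3 * (- Ln (1 - of_real y)) + 4 * (- Ln (1 - of_real y * z)) + (- Ln (1 - of_real y * z ^ 2)))"
    by (rule sums_Re)
  have N: "0 \<le> Re (3 * ((of_real y) ^ n / of_nat n) + 4 * ((of_real y * z) ^ n / of_nat n) + (of_real y * z ^ 2) ^ n / of_nat n)" for n
  proof -
    define v where "v = z ^ n"
    have "norm v \<le> 1" using z by (simp add: v_def norm_power power_le_one)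
    hence "(Re v)^2 + (Im v)^2 \<le> 1" by (simp add: cmod_def)
    hence nn: "0 \<le> Re (3 + 4 * v + v ^ 2)"
      using zero_le_power2[of "Re v + 1"] by (simp add: power2_eq_square algebra_simps)
    have "3 * ((of_real y) ^ n / of_nat n) + 4 * ((of_real y * z) ^ n / of_nat n) + (of_real y * z ^ 2) ^ n / of_nat n
      = of_real (y ^ n / real n) * (3 + 4 * v + v ^ 2)"
      by (simp add: v_def power_mult_distrib power_mult[symmetric] mult.commute[of 2] algebra_simps add_divide_distrib)
    hence "Re (3 * ((of_real y) ^ n / of_nat n) + 4 * ((of_real y * z) ^ n / of_nat n) + (of_real y * z ^ 2) ^ n / of_nat n)
      = (y ^ n / real n) * Re (3 + 4 * v + v ^ 2)"
      by (simp only: times_complex.sel Re_complex_of_real Im_complex_of_real mult_zero_left diff_0_right)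
    thus ?thesis using nn y by simp
  qed
  show ?thesis by (rule sums_le[OF N sums_zero S])
qed

text \<open>The 3-4-1 inequality with y = p^(-\<sigma>) and z = c(p) p^(-it), summed over all primes
  and exponentiated.\<close>

lemma norm_zeta_L_L_ge_1:
  fixes c :: "nat \<Rightarrow> complex"
  assumes mult: "\<And>m n. c (m * n) = c m * c n" and c1: "c 1 = 1" and c: "\<And>n. norm (c n) \<le> 1"
    and \<sigma>: "\<sigma> > 1"
  shows "norm (dirichlet_L (\<lambda>_. 1) (of_real \<sigma>)) ^ 3 * norm (dirichlet_L c (Complex \<sigma> t)) ^ 4 *
       norm (dirichlet_L (\<lambda>n. c n ^ 2) (Complex \<sigma> (2 * t))) \<ge> 1"
proof -
  define A where "A = (\<lambda>c s. dirichlet_L (on_primes c) s + log_L_remainder c s)"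
  let ?c2 = "\<lambda>n. c n ^ 2"
  have c2: "norm (?c2 n) \<le> 1" for n using c[of n] by (simp add: norm_power power_le_one)
  have "(\<lambda>n. 3 * (- Ln (1 - on_primes (\<lambda>_. 1) n / of_nat n powr (of_real \<sigma>))) +
      4 * (- Ln (1 - on_primes c n / of_nat n powr (Complex \<sigma> t))) +
      (- Ln (1 - on_primes ?c2 n / of_nat n powr (Complex \<sigma> (2 * t)))))
     sums (3 * A (\<lambda>_. 1) (of_real \<sigma>) + 4 * A c (Complex \<sigma> t) + A ?c2 (Complex \<sigma> (2 * t)))"
    unfolding A_def using \<sigma> c c2 by (intro sums_add sums_mult log_L_sums) auto
  hence S: "(\<lambda>n. Re (3 * (- Ln (1 - on_primes (\<lambda>_. 1) n / of_nat n powr (of_real \<sigma>))) +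
      4 * (- Ln (1 - on_primes c n / of_nat n powr (Complex \<sigma> t))) +
      (- Ln (1 - on_primes ?c2 n / of_nat n powr (Complex \<sigma> (2 * t))))))
     sums Re (3 * A (\<lambda>_. 1) (of_real \<sigma>) + 4 * A c (Complex \<sigma> t) + A ?c2 (Complex \<sigma> (2 * t)))"
    by (rule sums_Re)
  have N: "0 \<le> Re (3 * (- Ln (1 - on_primes (\<lambda>_. 1) n / of_nat n powr (of_real \<sigma>))) +
      4 * (- Ln (1 - on_primes c n / of_nat n powr (Complex \<sigma> t))) +
      (- Ln (1 - on_primes ?c2 n / of_nat n powr (Complex \<sigma> (2 * t)))))" for n
  proof (cases "prime n")
    case True
    hence n: "n \<ge> 2" by (rule prime_ge_2_nat)
    define y where "y = 1 / real n powr \<sigma>"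
    define z where "z = c n / of_nat n powr (Complex 0 t)"
    have "real n powr \<sigma> > real n powr 0" using n \<sigma> by (intro powr_less_mono) auto
    hence y: "0 \<le> y" "y < 1" using n by (auto simp: y_def)
    have z: "norm z \<le> 1" using c[of n] n by (simp add: z_def norm_divide_nat_powr)
    have yp: "of_real y = 1 / (of_nat n :: complex) powr (of_real \<sigma>)"
      using powr_of_real[of "real n" \<sigma>] by (simp add: y_def)
    have 1: "c n / of_nat n powr (Complex \<sigma> t) = of_real y * z"
    proof -
      have "Complex \<sigma> t = of_real \<sigma> + Complex 0 t" by (simp add: complex_eq_iff)
      thus ?thesis using n by (simp add: powr_add yp z_def)
    qed
    have 2: "c n ^ 2 / of_nat n powr (Complex \<sigma> (2 * t)) = of_real y * z ^ 2"
    proof -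
      have e: "Complex \<sigma> (2 * t) = of_real \<sigma> + Complex 0 t + Complex 0 t" by (simp add: complex_eq_iff)
      show ?thesis using n by (simp only: e powr_add yp z_def power2_eq_square) simp
    qed
    show ?thesis
      using three_four_one[OF y z] True by (simp only: on_primes_def if_True 1 2 yp[symmetric])
  qed (simp add: on_primes_def)
  have ge: "Re (3 * A (\<lambda>_. 1) (of_real \<sigma>) + 4 * A c (Complex \<sigma> t) + A ?c2 (Complex \<sigma> (2 * t))) \<ge> 0"
    by (rule sums_le[OF N sums_zero S])
  have "1 \<le> norm (exp (3 * A (\<lambda>_. 1) (of_real \<sigma>) + 4 * A c (Complex \<sigma> t) + A ?c2 (Complex \<sigma> (2 * t))))"
    using ge by (simp add: norm_exp_eq_Re)
  also have "exp (3 * A (\<lambda>_. 1) (of_real \<sigma>) + 4 * A c (Complex \<sigma> t) + A ?c2 (Complex \<sigma> (2 * t))) =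
     exp (A (\<lambda>_. 1) (of_real \<sigma>)) ^ 3 * exp (A c (Complex \<sigma> t)) ^ 4 * exp (A ?c2 (Complex \<sigma> (2 * t)))"
    by (simp add: exp_add exp_of_nat_mult[symmetric])
  also have "exp (A (\<lambda>_. 1) (of_real \<sigma>)) = dirichlet_L (\<lambda>_. 1) (of_real \<sigma>)"
    unfolding A_def using \<sigma> by (intro exp_log_zeta) auto
  also have "exp (A c (Complex \<sigma> t)) = dirichlet_L c (Complex \<sigma> t)"
    unfolding A_def using \<sigma> by (intro exp_log_L mult c1 c) auto
  also have "exp (A ?c2 (Complex \<sigma> (2 * t))) = dirichlet_L ?c2 (Complex \<sigma> (2 * t))"
    unfolding A_def using \<sigma> c1 by (intro exp_log_L c2) (auto simp: mult power_mult_distrib)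
  finally show ?thesis by (simp add: norm_mult norm_power)
qed

lemma dirichlet_char_square:
  assumes "dirichlet_char q chi" shows "dirichlet_char q (\<lambda>n. chi n ^ 2)"
  using assms by (auto simp: dirichlet_char_def power_mult_distrib)

lemma holomorphic_dirichlet_char_L:
  assumes "dirichlet_char q chi" "\<not> principal_char q chi"
  shows "dirichlet_L chi holomorphic_on {s. Re s > 0}"
  by (rule holomorphic_dirichlet_L[OF dirichlet_char_0[OF assms] norm_sum_dirichlet_char_le[OF assms]])

text \<open>If L vanished at s = 1 + it, then along s + h with h decreasing to 0 the cube of zeta
  would grow like h^(-3), the fourth power of L would be O(h^4), and the third factor would stay
  bounded since the squared character is nonprincipal. The product would be O(h), but it is at least
  1.\<close>

lemma dirichlet_L_nonzero_Re_1:
  assumes chi: "dirichlet_char q chi" and np: "\<not> principal_char q chi"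
    and np2: "\<not> principal_char q (\<lambda>n. chi n ^ 2)" and s: "Re s = 1"
  shows "dirichlet_L chi s \<noteq> 0"
proof
  assume zero: "dirichlet_L chi s = 0"
  define t where "t = Im s"
  have s_eq: "s = Complex 1 t" using s by (simp add: t_def complex_eq_iff)
  let ?c2 = "\<lambda>n. chi n ^ 2"
  have op: "open {s. Re s > 0}" by (rule open_halfspace_Re_gt)
  note hol1 = holomorphic_dirichlet_char_L[OF chi np]
  note hol2 = holomorphic_dirichlet_char_L[OF dirichlet_char_square[OF chi] np2]
  have toc: "filterlim (\<lambda>h::real. of_real h :: complex) (at 0) (at_right 0)"
    by (auto simp: filterlim_at eventually_at_filter intro!: tendsto_eq_intros)
  have toc': "((\<lambda>h::real. of_real h :: complex) \<longlongrightarrow> 0) (at_right 0)"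
    by (auto intro!: tendsto_eq_intros)
  have isC: "isCont f z" if "f holomorphic_on {s. Re s > 0}" "Re z > 0" for f z
    using that holomorphic_on_imp_continuous_on continuous_on_eq_continuous_at[OF op] by blast
  have cont: "((\<lambda>h::real. f (z + of_real h)) \<longlongrightarrow> f z) (at_right 0)"
    if "f holomorphic_on {s. Re s > 0}" "Re z > 0" for f z
    using toc' by (intro isCont_tendsto_compose[OF isC[OF that]]) (auto intro!: tendsto_eq_intros)
  have "((\<lambda>h::complex. (dirichlet_L chi (s + h) - dirichlet_L chi s) / h) \<longlongrightarrow> deriv (dirichlet_L chi) s) (at 0)"
    using holomorphic_derivI[OF hol1 op, of s UNIV] s unfolding DERIV_def by simp
  from filterlim_compose[OF this toc]
  have lim1: "((\<lambda>h::real. dirichlet_L chi (s + of_real h) / of_real h) \<longlongrightarrow> deriv (dirichlet_L chi) s) (at_right 0)"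
    by (simp add: zero)
  have lim0: "((\<lambda>h::real. zeta_reg (1 + of_real h)) \<longlongrightarrow> zeta_reg 1) (at_right 0)"
    by (rule cont[OF holomorphic_zeta_reg]) auto
  have lim2: "((\<lambda>h::real. dirichlet_L ?c2 (Complex 1 (2 * t) + of_real h)) \<longlongrightarrow> dirichlet_L ?c2 (Complex 1 (2 * t))) (at_right 0)"
    by (rule cont[OF hol2]) auto
  have "((\<lambda>h::real. norm (zeta_reg (1 + of_real h)) ^ 3 * norm (dirichlet_L chi (s + of_real h) / of_real h) ^ 4 *
       (h * norm (dirichlet_L ?c2 (Complex 1 (2 * t) + of_real h)))) \<longlongrightarrow> 
     norm (zeta_reg 1) ^ 3 * norm (deriv (dirichlet_L chi) s) ^ 4 * (0 * norm (dirichlet_L ?c2 (Complex 1 (2 * t))))) (at_right 0)"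
    by (intro tendsto_intros lim0 lim1 lim2)
  moreover have "\<forall>\<^sub>F h in at_right (0::real). 1 \<le> norm (zeta_reg (1 + of_real h)) ^ 3 * norm (dirichlet_L chi (s + of_real h) / of_real h) ^ 4 *
       (h * norm (dirichlet_L ?c2 (Complex 1 (2 * t) + of_real h)))"
    using eventually_at_right_less[of "0::real"]
  proof eventually_elim
    case (elim h)
    have "1 \<le> norm (dirichlet_L (\<lambda>_. 1) (of_real (1 + h))) ^ 3 * norm (dirichlet_L chi (Complex (1 + h) t)) ^ 4 *
       norm (dirichlet_L ?c2 (Complex (1 + h) (2 * t)))"
      using chi dirichlet_char_1[OF chi] norm_dirichlet_char_le[OF chi] elim
      by (intro norm_zeta_L_L_ge_1) (auto simp: dirichlet_char_def)
    also have "norm (dirichlet_L (\<lambda>_. 1) (of_real (1 + h))) = norm (zeta_reg (1 + of_real h)) / h"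
      using zeta_reg_eq[of "of_real (1 + h)"] elim by (simp add: norm_mult)
    also have "Complex (1 + h) t = s + of_real h" by (simp add: s_eq complex_eq_iff)
    also have "norm (dirichlet_L chi (s + of_real h)) = h * norm (dirichlet_L chi (s + of_real h) / of_real h)"
      using elim by (simp add: norm_divide)
    also have "Complex (1 + h) (2 * t) = Complex 1 (2 * t) + of_real h" by (simp add: complex_eq_iff)
    also have "(a / h) ^ 3 * (h * b) ^ 4 * d = a ^ 3 * b ^ 4 * (h * d)" for a b d :: real
      using elim by (simp add: field_simps eval_nat_numeral)
    finally show ?case .
  qed
  ultimately have "1 \<le> norm (zeta_reg 1) ^ 3 * norm (deriv (dirichlet_L chi) s) ^ 4 * (0 * norm (dirichlet_L ?c2 (Complex 1 (2 * t))))"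
    by (rule tendsto_lowerbound) simp
  thus False by simp
qed

lemma dirichlet_L_nonzero_Re_gt_1:
  assumes "dirichlet_char q chi" "Re s > 1" shows "dirichlet_L chi s \<noteq> 0"
proof -
  have "exp (dirichlet_L (on_primes chi) s + log_L_remainder chi s) = dirichlet_L chi s"
    using assms dirichlet_char_1[OF assms(1)] norm_dirichlet_char_le[OF assms(1)]
    by (intro exp_log_L) (auto simp: dirichlet_char_def)
  thus ?thesis using exp_not_eq_zero by metis
qed

section \<open>Weighted sums over primes\<close>

lemma holomorphic_dirichlet_L_Re_gt_1:
  fixes x :: "nat \<Rightarrow> complex"
  assumes x: "\<And>n. norm (x n) \<le> 1"
  shows "dirichlet_L x holomorphic_on {s. Re s > 1}"
proof -
  have "(\<lambda>s. \<Sum>n. x n / of_nat n powr s) holomorphic_on {s. Re s > 1}"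
  proof (rule holomorphic_on_suminf_halfplane)
    show "(\<lambda>s. x n / of_nat n powr s) holomorphic_on {s. Re s > 1}" for n
      by (cases "n = 0") (auto intro!: holomorphic_intros)
    fix b C :: real assume b: "b > 1"
    show "\<exists>M. summable M \<and> (\<forall>n s. b \<le> Re s \<longrightarrow> cmod s \<le> C \<longrightarrow> norm (x n / of_nat n powr s) \<le> M n)"
    proof (intro exI[of _ "\<lambda>n. 1 / real n powr b"] conjI allI impI)
      show "summable (\<lambda>n. 1 / real n powr b)" using b by (rule summable_inverse_powr)
      fix n s assume s: "b \<le> Re s" "norm s \<le> C"
      have "norm (x n / of_nat n powr s) \<le> 1 / real n powr Re s"
        unfolding norm_divide_nat_powr using x by (intro divide_right_mono) auto
      also have "\<dots> \<le> 1 / real n powr b" using s by (intro inverse_powr_mono)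
      finally show "norm (x n / of_nat n powr s) \<le> 1 / real n powr b" .
    qed
  qed
  thus ?thesis by (simp add: dirichlet_L_def[abs_def])
qed

lemma holomorphic_log_L_remainder:
  assumes "\<And>n. norm (c n) \<le> 1"
  shows "log_L_remainder c holomorphic_on {s. Re s > 1/2}"
  using holomorphic_log_remainder[OF norm_on_primes_le[of c, OF assms] on_primes_lt_2[of _ c]]
  by (simp add: log_L_remainder_def[abs_def])

lemma ball_Re_gt: "s \<in> ball (1 + of_real r) R \<Longrightarrow> Re s > 1 + r - R"
  using abs_Re_le_cmod[of "s - (1 + of_real r)"] by (simp add: dist_norm norm_minus_commute)

text \<open>The closed disc of radius \<open>r\<close> lies in Re s > 1 except for the point 1,
  where \<open>zeta_reg\<close> is 1; no zero-free line is needed. Compactness gives a slightly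
  larger zero-free disc. Keeping R < r + 1/2 ensures Re s > 1/2, where the prime power part
  converges.\<close>

lemma zeta_reg_log_exists:
  assumes r: "r > 0"
  obtains R h where "R > r" "R < r + 1/2" "h holomorphic_on ball (1 + of_real r) R"
    "\<And>s. s \<in> ball (1 + of_real r) R \<Longrightarrow> exp (h s) = zeta_reg s"
proof -
  let ?z0 = "1 + complex_of_real r"
  define U where "U = {s. Re s > 1/2} \<inter> zeta_reg -` (- {0})"
  have oU: "open U" unfolding U_def
    by (intro continuous_open_preimage holomorphic_on_imp_continuous_on
          holomorphic_on_subset[OF holomorphic_zeta_reg] open_halfspace_Re_gt) auto
  have "cball ?z0 r \<subseteq> U"
  proof
    fix s assume s: "s \<in> cball ?z0 r"
    hence n: "norm (s - ?z0) \<le> r" by (simp add: dist_norm norm_minus_commute)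
    hence re: "Re s \<ge> 1" using abs_Re_le_cmod[of "s - ?z0"] by simp
    show "s \<in> U"
    proof (cases "Re s = 1")
      case True
      have "norm (s - ?z0) ^ 2 \<le> r ^ 2" using n by (intro power_mono) auto
      hence "Im s = 0" using True by (simp add: cmod_power2)
      hence "s = 1" using True by (simp add: complex_eq_iff)
      thus ?thesis by (simp add: U_def zeta_reg_1)
    next
      case False
      thus ?thesis using re zeta_reg_nonzero[of s] by (simp add: U_def)
    qed
  qed
  then obtain \<epsilon> where e: "\<epsilon> > 0" "(\<Union>x\<in>cball ?z0 r. cball x \<epsilon>) \<subseteq> U"
    using compact_subset_open_imp_cball_epsilon_subset[OF compact_cball oU] by metis
  define R where "R = r + min \<epsilon> (1/4)"
  have R: "R > r" "R < r + 1/2" "R \<le> r + \<epsilon>" using e by (auto simp: R_def)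
  have sub: "ball ?z0 R \<subseteq> U"
  proof
    fix s assume "s \<in> ball ?z0 R"
    hence s: "norm (s - ?z0) < R" by (simp add: dist_norm norm_minus_commute)
    show "s \<in> U"
    proof (cases "norm (s - ?z0) \<le> r")
      case True
      hence "s \<in> cball ?z0 r" by (simp add: dist_norm norm_minus_commute)
      thus ?thesis using e by (force intro: subsetD[OF e(2)])
    next
      case False
      define N where "N = norm (s - ?z0)"
      have N: "N > r" "N < R" using False s by (auto simp: N_def)
      \<comment> \<open>Radial projection onto the closed disc of radius \<open>r\<close>; it moves
        s by N - r, which is less than \<open>\<epsilon>\<close>.\<close>
      define x where "x = ?z0 + of_real (r / N) * (s - ?z0)"
      have "dist ?z0 x = r / N * N" using r N by (simp add: x_def dist_norm norm_mult N_def del: of_real_divide)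
      hence xc: "x \<in> cball ?z0 r" using r N by simp
      have "s - x = of_real (1 - r / N) * (s - ?z0)" by (simp add: x_def algebra_simps)
      hence "norm (s - x) = \<bar>1 - r / N\<bar> * N" by (simp add: norm_mult N_def del: of_real_divide of_real_diff)
      also have "\<dots> = N - r" using r N by (simp add: field_simps)
      finally have "s \<in> cball x \<epsilon>" using N R by (simp add: dist_norm norm_minus_commute)
      thus ?thesis using e(2) xc by blast
    qed
  qed
  obtain h where "h holomorphic_on ball ?z0 R" "\<And>s. s \<in> ball ?z0 R \<Longrightarrow> exp (h s) = zeta_reg s"
  proof (rule holomorphic_logarithm_exists[of "ball ?z0 R" zeta_reg ?z0])
    show "zeta_reg holomorphic_on ball ?z0 R"
      by (rule holomorphic_on_subset[OF holomorphic_zeta_reg]) (use sub in \<open>force simp: U_def\<close>)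
    show "zeta_reg x \<noteq> 0" if "x \<in> ball ?z0 R" for x using sub that by (auto simp: U_def)
  qed (use R r in auto)
  thus ?thesis using that R by blast
qed

text \<open>Logarithmic series in u / r. At k = 0 the quotient by \<open>of_nat 0\<close> is 0, so
  only - ln r remains there.\<close>

lemma Ln_powser:
  assumes r: "r > 0" and u: "norm u < r"
  shows "(\<lambda>k. ((if k = 0 then - of_real (ln r) else 0) + (- 1 / of_real r) ^ k / of_nat k) * u ^ k)
     sums (- Ln (of_real r + u))"
proof -
  let ?v = "u / of_real r"
  have v: "norm ?v < 1" using r u by (simp add: norm_divide)
  have nz: "1 + ?v \<noteq> 0"
  proof
    assume "1 + ?v = 0"
    hence "?v = -1" by (simp add: eq_neg_iff_add_eq_0 add.commute)
    thus False using v by simp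
  qed
  have "of_real r + u = of_real r * (1 + ?v)" using r by (simp add: field_simps)
  hence ln: "- Ln (of_real r + u) = - of_real (ln r) + - Ln (1 + ?v)"
    using Ln_times_of_real[OF r nz] Ln_of_real[OF r] by simp
  have "(\<lambda>k. - (- ((- ?v) ^ k) / of_nat k)) sums (- Ln (1 + ?v))"
    by (rule sums_minus[OF Ln_series'[OF v]])
  moreover have "(\<lambda>k. if k = 0 then - of_real (ln r) else 0 :: complex) sums (- of_real (ln r))"
    using sums_single[of 0 "\<lambda>_. - of_real (ln r) :: complex"] by simp
  ultimately have "(\<lambda>k. (if k = 0 then - of_real (ln r) else 0) + - (- ((- ?v) ^ k) / of_nat k)) sums (- Ln (of_real r + u))"
    unfolding ln by (intro sums_add)
  also have "(\<lambda>k. (if k = 0 then - of_real (ln r) else 0) + - (- ((- ?v) ^ k) / of_nat k)) =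
     (\<lambda>k. ((if k = 0 then - of_real (ln r) else 0) + (- 1 / of_real r) ^ k / of_nat k) * u ^ k)"
  proof
    fix k
    have "- ?v = (- 1 / of_real r) * u" by simp
    hence "(- ?v) ^ k = (- 1 / of_real r) ^ k * u ^ k" by (metis power_mult_distrib)
    thus "(if k = 0 then - of_real (ln r) else 0) + - (- ((- ?v) ^ k) / of_nat k) =
      ((if k = 0 then - of_real (ln r) else 0) + (- 1 / of_real r) ^ k / of_nat k) * u ^ k"
      by (simp add: algebra_simps)
  qed
  finally show ?thesis .
qed

text \<open>The \<open>k\<close>-th Taylor coefficient of \<open>- Ln (s - 1)\<close> contributes \<open>1 / k\<close> at \<open>s = 1\<close>, so the
  truncation produces a harmonic number, which is where Euler's constant comes from.\<close>

lemma weighted_prime_sum_asymptotics: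
  assumes r: "r > 0"
  shows "(\<lambda>K. Re (\<Sum>n. on_primes (\<lambda>_. 1) n / of_nat n * of_real (poisson_weight r K n)) - ln (real K))
     \<longlonglongrightarrow> euler_mascheroni - ln r - Re (log_L_remainder (\<lambda>_. 1) 1)"
proof -
  let ?z0 = "1 + complex_of_real r" and ?one = "\<lambda>_::nat. 1 :: complex"
  obtain R h where R: "R > r" "R < r + 1/2" and h: "h holomorphic_on ball ?z0 R"
    and eh: "\<And>s. s \<in> ball ?z0 R \<Longrightarrow> exp (h s) = zeta_reg s"
    using zeta_reg_log_exists[OF r] by blast
  have op: "norm (on_primes ?one n) \<le> 1" for n by (simp add: on_primes_def)
  \<comment> \<open>Up to an additive constant, \<open>g\<close> is the prime sum plus Ln (s - 1):
    the part that stays holomorphic across s = 1.\<close>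
  define g where "g = (\<lambda>s. h s - log_L_remainder ?one s)"
  have reR: "Re s > 1/2" if "s \<in> ball ?z0 R" for s using ball_Re_gt[OF that] R by linarith
  have rer: "Re s > 1" if "s \<in> ball ?z0 r" for s using ball_Re_gt[OF that] by simp
  have holQ: "log_L_remainder ?one holomorphic_on ball ?z0 R"
    by (rule holomorphic_on_subset[OF holomorphic_log_L_remainder]) (use reR in auto)
  have holg: "g holomorphic_on ball ?z0 R" unfolding g_def by (intro holomorphic_intros h holQ)
  have sub: "ball ?z0 r \<subseteq> ball ?z0 R" using R by auto
  have holP: "dirichlet_L (on_primes ?one) holomorphic_on ball ?z0 r"
    by (rule holomorphic_on_subset[OF holomorphic_dirichlet_L_Re_gt_1[OF op]]) (use rer in auto)
  obtain c where c: "exp c = 1"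
    "\<And>s. s \<in> ball ?z0 r \<Longrightarrow> dirichlet_L (on_primes ?one) s = (g s - Ln (s - 1)) + c"
  proof (rule exp_eq_imp_differ_by_constant[of "ball ?z0 r" "\<lambda>s. g s - Ln (s - 1)" "dirichlet_L (on_primes ?one)"])
    have "(\<lambda>s. g s - Ln (s - 1)) holomorphic_on ball ?z0 r"
      using rer by (intro holomorphic_intros holomorphic_on_subset[OF holg sub])
        (force simp: complex_nonpos_Reals_iff)
    thus "continuous_on (ball ?z0 r) (\<lambda>s. g s - Ln (s - 1))" by (rule holomorphic_on_imp_continuous_on)
    show "continuous_on (ball ?z0 r) (dirichlet_L (on_primes ?one))"
      using holP by (rule holomorphic_on_imp_continuous_on)
    fix s assume s: "s \<in> ball ?z0 r"
    have s1: "s \<noteq> 1" using rer[OF s] by auto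
    have "exp (dirichlet_L (on_primes ?one) s + log_L_remainder ?one s) * (s - 1) = zeta_reg s"
      using exp_log_zeta[OF rer[OF s]] zeta_reg_eq[OF rer[OF s]] by simp
    also have "\<dots> = exp (h s)" using eh sub s by (metis subsetD)
    finally show "exp (dirichlet_L (on_primes ?one) s) = exp (g s - Ln (s - 1))"
      using s1 by (simp add: g_def exp_diff exp_add field_simps)
  qed auto
  have Rec: "Re c = 0" using c(1) norm_exp_eq_Re[of c] by simp
  define d where "d = (\<lambda>k. (deriv ^^ k) g ?z0 / fact k)"
  define a where "a = (\<lambda>k. d k + (((if k = 0 then - of_real (ln r) else 0) + (- 1 / of_real r) ^ k / of_nat k) + (if k = 0 then c else 0)))"
  have ser: "(\<lambda>k. a k * u ^ k) sums (\<Sum>n. on_primes ?one n / of_nat n powr (1 + of_real r + u))" if u: "norm u < r" for u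
  proof -
    have s: "?z0 + u \<in> ball ?z0 r" using u by (simp add: dist_norm)
    have "(\<lambda>k. d k * u ^ k) sums g (?z0 + u)"
      using holomorphic_power_series[OF holg, of "?z0 + u"] s sub by (auto simp: d_def)
    moreover have "(\<lambda>k. (if k = 0 then c else 0) * u ^ k) sums c"
    proof -
      have "(\<lambda>k. (if k = 0 then c else 0) * u ^ k) = (\<lambda>k. if k = 0 then c else 0)" by auto
      thus ?thesis using sums_single[of 0 "\<lambda>_. c"] by simp
    qed
    ultimately have "(\<lambda>k. d k * u ^ k + (((if k = 0 then - of_real (ln r) else 0) + (- 1 / of_real r) ^ k / of_nat k) * u ^ k + (if k = 0 then c else 0) * u ^ k))
       sums (g (?z0 + u) + (- Ln (of_real r + u) + c))"
      by (intro sums_add Ln_powser r u)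
    moreover have "g (?z0 + u) + (- Ln (of_real r + u) + c) = dirichlet_L (on_primes ?one) (?z0 + u)"
      using c(2)[OF s] by simp
    ultimately show ?thesis unfolding a_def dirichlet_L_def by (simp only: ring_distribs)
  qed
  have eq: "(\<Sum>n. on_primes ?one n / of_nat n * of_real (poisson_weight r K n)) =
     (\<Sum>k\<le>K. d k * (- of_real r) ^ k) - of_real (ln r) + of_real (harm K) + c" for K
  proof -
    have "(\<Sum>n. on_primes ?one n / of_nat n * of_real (poisson_weight r K n)) = (\<Sum>k\<le>K. a k * (- of_real r) ^ k)"
      using taylor_truncation_eq_weighted_sum(1)[OF op r ser] by (simp add: sums_iff)
    also have "\<dots> = (\<Sum>k\<le>K. d k * (- of_real r) ^ k + (if k = 0 then - of_real (ln r) + c else 0) + of_real (1 / real k))"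
    proof (rule sum.cong[OF refl])
      fix k
      have "(- 1 / of_real r) ^ k * (- of_real r :: complex) ^ k = ((- 1 / of_real r) * (- of_real r)) ^ k"
        by (simp only: power_mult_distrib)
      also have "\<dots> = 1" using r by simp
      finally have "(- 1 / of_real r) ^ k * (- of_real r :: complex) ^ k = 1" .
      thus "a k * (- of_real r) ^ k = d k * (- of_real r) ^ k + (if k = 0 then - of_real (ln r) + c else 0) + of_real (1 / real k)"
        by (cases "k = 0") (auto simp: a_def ring_distribs)
    qed
    also have "\<dots> = (\<Sum>k\<le>K. d k * (- of_real r) ^ k) + (- of_real (ln r) + c) + of_real (\<Sum>k\<le>K. 1 / real k)"
      by (simp add: sum.distrib)
    also have "(\<Sum>k\<le>K. 1 / real k) = harm K"
    proof -
      have "(\<Sum>k\<le>K. 1 / real k) = (\<Sum>k\<in>{1..K}. 1 / real k)"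
        by (rule sum.mono_neutral_right) auto
      thus ?thesis by (simp add: harm_def inverse_eq_divide)
    qed
    finally show ?thesis by simp
  qed
  \<comment> \<open>The point 1 is on the boundary of the disc where the prime sum was expanded, but
    strictly inside the disc of \<open>g\<close>. So the Taylor polynomials of \<open>g\<close>
    converge there and only the harmonic number diverges.\<close>
  have one: "1 \<in> ball ?z0 R" using r R by (simp add: dist_norm)
  have "(\<lambda>k. d k * (1 - ?z0) ^ k) sums g 1"
    using holomorphic_power_series[OF holg one] by (simp add: d_def)
  hence "(\<lambda>K. Re (\<Sum>k\<le>K. d k * (- of_real r) ^ k)) \<longlonglongrightarrow> Re (g 1)"
    by (intro tendsto_Re) (simp add: sums_def_le)
  hence "(\<lambda>K. Re (\<Sum>k\<le>K. d k * (- of_real r) ^ k) - ln r + (harm K - ln (real K)) + Re c)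
     \<longlonglongrightarrow> Re (g 1) - ln r + euler_mascheroni + Re c"
    by (intro tendsto_add tendsto_diff tendsto_const euler_mascheroni_LIMSEQ)
  \<comment> \<open>The logarithm \<open>h\<close> is fixed only up to multiples of 2 pi i, but its
    real part at 1 is ln 1 = 0.\<close>
  also have "Re (g 1) = - Re (log_L_remainder ?one 1)"
  proof -
    have "norm (exp (h 1)) = 1" using eh[OF one] by (simp add: zeta_reg_1)
    hence "Re (h 1) = 0" by (simp add: norm_exp_eq_Re)
    thus ?thesis by (simp add: g_def)
  qed
  finally show ?thesis unfolding eq by (simp add: Rec algebra_simps)
qed

lemma dirichlet_L_nonzero_GRH:
  assumes GRH and chi: "dirichlet_char q chi" "\<not> principal_char q chi" "\<not> principal_char q (\<lambda>n. chi n ^ 2)"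
    and s: "Re s > 1/2"
  shows "dirichlet_L chi s \<noteq> 0"
proof -
  consider "Re s < 1" | "Re s = 1" | "Re s > 1" by linarith
  thus ?thesis
  proof cases
    case 1
    have "0 < Re s" "Re s \<noteq> 1/2" using s by auto
    thus ?thesis using assms(1) 1 chi unfolding GRH_def by blast
  next
    case 2 thus ?thesis using dirichlet_L_nonzero_Re_1[OF chi] by simp
  next
    case 3 thus ?thesis using dirichlet_L_nonzero_Re_gt_1[OF chi(1)] by simp
  qed
qed

text \<open>\<open>B\<close> depends only on \<open>r\<close> and \<open>R'\<close>, so
  \<open>K\<close> may later grow with q. The condition q >= 3 gives ln q >= 1, which lets bounded
  quantities be absorbed into multiples of ln q.\<close>

lemma log_norm_L_approx:
  assumes GRH and r: "0 < r" "r < R'" "R' < r + 1/2"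
  shows "\<exists>B. \<forall>q chi K. q \<ge> 3 \<longrightarrow> dirichlet_char q chi \<longrightarrow> \<not> principal_char q chi \<longrightarrow>
     \<not> principal_char q (\<lambda>n. chi n ^ 2) \<longrightarrow>
     \<bar>ln (norm (dirichlet_L chi 1)) - (Re (\<Sum>n. on_primes chi n / of_nat n * of_real (poisson_weight r K n))
        + Re (log_L_remainder chi 1))\<bar> \<le> B * ln (real q) * (r / R') ^ K"
proof -
  let ?z0 = "1 + complex_of_real r"
  \<comment> \<open>Three radii: on \<open>R\<close> the real part is bounded above, on
    \<open>R'\<close> Borel-Caratheodory bounds the norm, and \<open>r\<close> reaches s = 1. The
    midpoint leaves room on both sides, so that \<open>b\<close>, a lower bound for Re s on the
    large disc, exceeds 1/2.\<close>
  define R where "R = (R' + r + 1/2) / 2"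
  define b where "b = 1 + r - R"
  have R: "R' < R" "R < r + 1/2" "b > 1/2" "0 < R'" "r < R" using r by (auto simp: R_def b_def field_simps)
  define D where "D = (\<Sum>n. 1 / real n powr (3/2))"
  define E where "E = (3 + 2 * r) * D"
  define Qb where "Qb = 4 * (\<Sum>n. 1 / real n powr (2 * b))"
  define G0 where "G0 = (\<Sum>n. 1 / real n powr (1 + r))"
  define B1 where "B1 = 2 * R' / (R - R') * (2 + \<bar>ln E\<bar> + Qb + G0) + G0"
  have smD: "summable (\<lambda>n. 1 / real n powr (3/2))" by (rule summable_inverse_powr) simp
  have smG: "summable (\<lambda>n. 1 / real n powr (1 + r))" using r by (intro summable_inverse_powr) simp
  have smQ: "summable (\<lambda>n. 1 / real n powr (2 * b))" using R by (intro summable_inverse_powr) simp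
  have "D > 0" unfolding D_def by (rule suminf_pos2[OF smD, of 1]) auto
  hence E: "E > 0" using r by (simp add: E_def)
  have G0: "G0 \<ge> 0" unfolding G0_def by (intro suminf_nonneg smG) auto
  have Qb: "Qb \<ge> 0" unfolding Qb_def using suminf_nonneg[OF smQ] by simp
  show ?thesis
  proof (intro exI[of _ "B1 / (1 - r / R')"] allI impI)
    fix q :: nat and chi K
    assume q: "q \<ge> 3" and chi: "dirichlet_char q chi" and np: "\<not> principal_char q chi"
      and np2: "\<not> principal_char q (\<lambda>n. chi n ^ 2)"
    have lnq: "ln (real q) \<ge> 1"
    proof -
      have "exp 1 \<le> (3 :: real)" by (rule exp_le)
      also have "3 \<le> real q" using q by simp
      finally have "exp 1 \<le> real q" .
      thus ?thesis using q by (subst ln_ge_iff) auto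
    qed
    note c = norm_dirichlet_char_le[OF chi]
    note op = norm_on_primes_le[of chi, OF c]
    have reR: "Re s > b" if "s \<in> ball ?z0 R" for s using ball_Re_gt[OF that] by (simp add: b_def)
    have rer: "Re s > 1" if "s \<in> ball ?z0 r" for s using ball_Re_gt[OF that] by simp
    have sub: "ball ?z0 r \<subseteq> ball ?z0 R" using R by auto
    have one: "1 \<in> ball ?z0 R" and z0R: "?z0 \<in> ball ?z0 R" using r R by (auto simp: dist_norm)
    have holL: "dirichlet_L chi holomorphic_on ball ?z0 R"
      by (rule holomorphic_on_subset[OF holomorphic_dirichlet_char_L[OF chi np]]) (use reR R in force)
    have nz: "dirichlet_L chi s \<noteq> 0" if "s \<in> ball ?z0 R" for s
      using reR[OF that] R by (intro dirichlet_L_nonzero_GRH[OF assms(1) chi np np2]) linarith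
    obtain h where h: "h holomorphic_on ball ?z0 R" and eh: "\<And>s. s \<in> ball ?z0 R \<Longrightarrow> exp (h s) = dirichlet_L chi s"
      using holomorphic_logarithm_exists[OF convex_ball open_ball holL nz z0R] by blast
    have holQ: "log_L_remainder chi holomorphic_on ball ?z0 R"
      by (rule holomorphic_on_subset[OF holomorphic_log_L_remainder[OF c]]) (use reR R in force)
    have holP: "dirichlet_L (on_primes chi) holomorphic_on ball ?z0 r"
      by (rule holomorphic_on_subset[OF holomorphic_dirichlet_L_Re_gt_1[OF op]]) (use rer in auto)
    have cont: "continuous_on (ball ?z0 r) (\<lambda>s. h s - log_L_remainder chi s)"
      by (intro continuous_intros holomorphic_on_imp_continuous_on holomorphic_on_subset[OF h sub]
            holomorphic_on_subset[OF holQ sub])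
    have expeq: "exp (dirichlet_L (on_primes chi) s) = exp (h s - log_L_remainder chi s)" if s: "s \<in> ball ?z0 r" for s
    proof -
      have "exp (dirichlet_L (on_primes chi) s + log_L_remainder chi s) = dirichlet_L chi s"
        using chi dirichlet_char_1[OF chi] c rer[OF s] by (intro exp_log_L) (auto simp: dirichlet_char_def)
      also have "\<dots> = exp (h s)" using eh sub s by (metis subsetD)
      finally show ?thesis by (simp add: exp_diff exp_add field_simps)
    qed
    obtain k where k: "exp k = 1"
      "\<And>s. s \<in> ball ?z0 r \<Longrightarrow> dirichlet_L (on_primes chi) s = (h s - log_L_remainder chi s) + k"
      by (rule exp_eq_imp_differ_by_constant[OF connected_ball cont holomorphic_on_imp_continuous_on[OF holP] expeq]) auto
    have Rek: "Re k = 0" using k(1) norm_exp_eq_Re[of k] by simp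
    \<comment> \<open>With the constant \<open>k\<close> included, \<open>g\<close> agrees with the
      prime sum on the disc of radius \<open>r\<close> and continues it to radius
      \<open>R\<close>.\<close>
    define g where "g = (\<lambda>s. h s - log_L_remainder chi s + k)"
    have holg: "g holomorphic_on ball ?z0 R" unfolding g_def by (intro holomorphic_intros h holQ)
    have Reg: "Re (g s) = ln (norm (dirichlet_L chi s)) - Re (log_L_remainder chi s)" if s: "s \<in> ball ?z0 R" for s
    proof -
      have "norm (dirichlet_L chi s) = exp (Re (h s))" using eh[OF s] by (metis norm_exp_eq_Re)
      thus ?thesis by (simp add: g_def Rek)
    qed
    \<comment> \<open>The summand 1 makes the bound on the real part strict, as Borel-Caratheodory
      requires.\<close>
    define A where "A = ln (real q) + \<bar>ln E\<bar> + Qb + 1"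
    have RegA: "Re (g s) < A" if s: "s \<in> ball ?z0 R" for s
    proof -
      have "norm s \<le> norm ?z0 + norm (s - ?z0)" by norm
      also have "norm ?z0 \<le> 1 + r" using norm_triangle_ineq[of 1 "of_real r :: complex"] r by simp
      also have "norm (s - ?z0) < r + 1/2" using s R by (simp add: dist_norm norm_minus_commute)
      finally have ns: "norm s \<le> 3 + 2 * r" by simp
      have "norm (dirichlet_L chi s) \<le> real q * norm s * D"
        unfolding D_def using reR[OF s] R
        by (intro norm_dirichlet_L_le[OF dirichlet_char_0[OF chi np] norm_sum_dirichlet_char_le[OF chi np]]) auto
      also have "\<dots> \<le> real q * (3 + 2 * r) * D" using ns \<open>D > 0\<close> by (intro mult_right_mono mult_left_mono) auto
      finally have "norm (dirichlet_L chi s) \<le> real q * E" by (simp add: E_def mult_ac)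
      hence "ln (norm (dirichlet_L chi s)) \<le> ln (real q * E)"
        using nz[OF s] q E by (subst ln_le_cancel_iff) auto
      also have "\<dots> = ln (real q) + ln E" using q E by (simp add: ln_mult)
      finally have 1: "ln (norm (dirichlet_L chi s)) \<le> ln (real q) + \<bar>ln E\<bar>" by linarith
      have "norm (log_L_remainder chi s) \<le> Qb"
        unfolding log_L_remainder_def Qb_def using reR[OF s] R
        by (intro norm_suminf_log_remainder_le op on_primes_lt_2) auto
      hence "- Re (log_L_remainder chi s) \<le> Qb" using abs_Re_le_cmod[of "log_L_remainder chi s"] by linarith
      thus ?thesis using 1 by (simp add: Reg[OF s] A_def)
    qed
    have gP: "g s = dirichlet_L (on_primes chi) s" if "s \<in> ball ?z0 r" for s
      using k(2)[OF that] by (simp add: g_def)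
    \<comment> \<open>At the centre the prime sum converges absolutely, which bounds the value there
      independently of q.\<close>
    have gz0: "norm (g ?z0) \<le> G0"
    proof -
      have "norm (dirichlet_L (on_primes chi) ?z0) \<le> G0"
        unfolding dirichlet_L_def G0_def
        by (rule norm_suminf_le[OF _ smG]) (auto simp: norm_divide_nat_powr intro!: divide_right_mono op)
      thus ?thesis using gP[of ?z0] r by simp
    qed
    have gB: "norm (g s) \<le> B1 * ln (real q)" if s: "norm (s - ?z0) \<le> R'" for s
    proof -
      have "norm (g s) \<le> 2 * R' / (R - R') * (A - Re (g ?z0)) + norm (g ?z0)"
        by (rule borel_caratheodory[OF holg R(4) R(1) RegA s])
      also have "\<dots> \<le> 2 * R' / (R - R') * (A + G0) + G0"
        using gz0 abs_Re_le_cmod[of "g ?z0"] R by (intro add_mono mult_left_mono) auto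
      also have "\<dots> \<le> 2 * R' / (R - R') * ((2 + \<bar>ln E\<bar> + Qb + G0) * ln (real q)) + G0 * ln (real q)"
      proof (intro add_mono mult_left_mono)
        have "(1 + \<bar>ln E\<bar> + Qb + G0) * 1 \<le> (1 + \<bar>ln E\<bar> + Qb + G0) * ln (real q)"
          using lnq G0 Qb by (intro mult_left_mono) auto
        thus "A + G0 \<le> (2 + \<bar>ln E\<bar> + Qb + G0) * ln (real q)" by (simp add: A_def algebra_simps)
        show "G0 \<le> G0 * ln (real q)" using lnq G0 mult_left_mono[of 1 "ln (real q)" G0] by simp
      qed (use R in auto)
      also have "\<dots> = B1 * ln (real q)" by (simp add: B1_def algebra_simps add_divide_distrib)
      finally show ?thesis .
    qed
    define d where "d = (\<lambda>k. (deriv ^^ k) g ?z0 / fact k)"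
    have ser: "(\<lambda>k. d k * u ^ k) sums (\<Sum>n. on_primes chi n / of_nat n powr (1 + of_real r + u))" if u: "norm u < r" for u
    proof -
      have s: "?z0 + u \<in> ball ?z0 r" using u by (simp add: dist_norm)
      have "(\<lambda>k. d k * u ^ k) sums g (?z0 + u)"
        using holomorphic_power_series[OF holg, of "?z0 + u"] s sub by (auto simp: d_def)
      thus ?thesis using gP[OF s] by (simp add: dirichlet_L_def)
    qed
    have "(\<Sum>n. on_primes chi n / of_nat n * of_real (poisson_weight r K n)) = (\<Sum>k\<le>K. d k * (- of_real r) ^ k)"
      using taylor_truncation_eq_weighted_sum(1)[OF op r(1) ser] by (simp add: sums_iff)
    moreover have "norm (g 1 - (\<Sum>k\<le>K. d k * (1 - ?z0) ^ k)) \<le> B1 * ln (real q) * (r / R') ^ K / (1 - r / R')"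
      unfolding d_def using r by (intro taylor_truncation_error[OF holg R(4) R(1) _ r(2)] gB) auto
    ultimately have "norm (g 1 - (\<Sum>n. on_primes chi n / of_nat n * of_real (poisson_weight r K n)))
       \<le> B1 / (1 - r / R') * ln (real q) * (r / R') ^ K" by simp
    hence "\<bar>Re (g 1 - (\<Sum>n. on_primes chi n / of_nat n * of_real (poisson_weight r K n)))\<bar>
       \<le> B1 / (1 - r / R') * ln (real q) * (r / R') ^ K"
      using abs_Re_le_cmod order_trans by blast
    thus "\<bar>ln (norm (dirichlet_L chi 1)) - (Re (\<Sum>n. on_primes chi n / of_nat n * of_real (poisson_weight r K n))
        + Re (log_L_remainder chi 1))\<bar> \<le> B1 / (1 - r / R') * ln (real q) * (r / R') ^ K"
      by (simp add: Reg[OF one] algebra_simps)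
  qed
qed

section \<open>Comparison of weighted sums\<close>

text \<open>The angle 2 pi j / l differs from pi by pi |2 j - l| / l, and for odd l the integer 2 j
  - l is nonzero. So an l-th root of unity stays at least pi / l away from -1 in angle.\<close>

lemma Re_root_of_unity_ge:
  assumes "odd l" "z ^ l = (1::complex)"
  shows "Re z \<ge> - cos (pi / real l)"
proof -
  have l: "l \<ge> 1" using assms(1) by (cases l) auto
  have "z \<in> {exp (2 * of_real pi * \<i> * of_nat j / of_nat l) |j. j < l}"
    using complex_roots_unity[OF l] assms(2) by blast
  then obtain j where j: "j < l" "z = exp (2 * of_real pi * \<i> * of_nat j / of_nat l)" by blast
  have "2 * of_real pi * \<i> * of_nat j / of_nat l = \<i> * of_real (2 * pi * real j / real l)"
    by (simp add: mult_ac)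
  hence "z = cis (2 * pi * real j / real l)" unfolding j(2) cis_conv_exp by (simp only:)
  hence Rez: "Re z = cos (2 * pi * real j / real l)" by simp
  define k :: real where "k = \<bar>2 * real j - real l\<bar>"
  have "2 * int j \<noteq> int l" using assms(1) by presburger
  hence "\<bar>2 * int j - int l\<bar> \<ge> 1" by linarith
  hence "real_of_int \<bar>2 * int j - int l\<bar> \<ge> 1" by linarith
  hence k1: "k \<ge> 1" by (simp add: k_def)
  have kl: "k \<le> real l" using j by (simp add: k_def abs_le_iff)
  have arg: "2 * pi * real j / real l = pi + pi * (2 * real j - real l) / real l"
    using l by (simp add: field_simps)
  have "Re z = - cos (pi * (2 * real j - real l) / real l)" unfolding Rez arg by (simp only: cos_periodic_pi2)
  moreover have "cos (pi * (2 * real j - real l) / real l) = cos (pi * k / real l)"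
    using cos_abs_real[of "pi * (2 * real j - real l) / real l"] by (simp add: k_def abs_mult)
  moreover have "cos (pi * k / real l) \<le> cos (pi / real l)"
  proof (rule cos_monotone_0_pi_le)
    show "pi / real l \<le> pi * k / real l" using k1 l by (simp add: divide_right_mono)
    show "pi * k / real l \<le> pi" using kl l by (simp add: field_simps)
  qed auto
  ultimately show ?thesis by simp
qed

abbreviation prime_remainder :: "complex \<Rightarrow> nat \<Rightarrow> real" where
  "prime_remainder z n \<equiv> Re (log_remainder (on_primes (\<lambda>_. z) n / of_nat n))"

lemma norm_prime_term_le:
  assumes "\<And>n. norm (c n) \<le> 1"
  shows "norm (log_remainder (on_primes c n / of_nat n)) \<le> 4 * (1 / real n ^ 2)"
    and "norm (on_primes c n / of_nat n) < 1"
proof -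
  note op = norm_on_primes_le[of c, OF assms] on_primes_lt_2[of _ c]
  have "norm (log_remainder (on_primes c n / of_nat n powr 1)) \<le> 4 * (1 / real n powr (2 * 1))"
    by (rule norm_log_remainder_term_le[OF op]) auto
  thus "norm (log_remainder (on_primes c n / of_nat n)) \<le> 4 * (1 / real n ^ 2)"
    by (cases "n = 0") (auto simp: powr_numeral)
  have "norm (on_primes c n / of_nat n powr 1) \<le> 3/4"
    by (rule norm_term_le_half[OF op]) auto
  thus "norm (on_primes c n / of_nat n) < 1" by simp
qed

lemma summable_inverse_squares_4: "summable (\<lambda>n. 4 * (1 / real n ^ 2))"
  using inverse_power_summable[of 2, where 'a = real]
  by (intro summable_mult) (simp add: inverse_eq_divide power_one_over)

lemma Re_log_L_remainder_1:
  assumes "\<And>n. norm (c n) \<le> 1"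
  shows "(\<lambda>n. Re (log_remainder (on_primes c n / of_nat n))) sums Re (log_L_remainder c 1)"
proof -
  have "summable (\<lambda>n. log_remainder (on_primes c n / of_nat n))"
    using norm_prime_term_le(1)[OF assms]
    by (intro summable_norm_cancel[OF summable_comparison_test'[OF summable_inverse_squares_4, of 0]]) auto
  hence "(\<lambda>n. log_remainder (on_primes c n / of_nat n)) sums log_L_remainder c 1"
    by (simp add: log_L_remainder_def summable_sums)
  thus ?thesis by (rule sums_Re)
qed

text \<open>The square of |1 - x/n| is 1 - 2 Re x / n + |x|^2 / n^2. Comparing norms instead of
  requiring them equal includes x = 0, the value of the character at primes dividing the
  modulus.\<close>

lemma norm_one_minus_le:
  fixes x z :: complex
  assumes "Re z \<le> Re x" "norm x \<le> norm z"
  shows "norm (1 - x / of_nat n) \<le> norm (1 - z / of_nat n)"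
proof (rule power2_le_imp_le)
  have sq: "norm (1 - x / of_nat n) ^ 2 = 1 - 2 * (Re x / real n) + (norm x / real n) ^ 2" for x :: complex
  proof -
    have "norm (1 - v) ^ 2 = 1 - 2 * Re v + norm v ^ 2" for v :: complex
      unfolding cmod_power2 by (simp add: power2_eq_square algebra_simps)
    from this[of "x / of_nat n"] show ?thesis by (simp add: norm_divide)
  qed
  have "Re z / real n \<le> Re x / real n" "(norm x / real n) ^ 2 \<le> (norm z / real n) ^ 2"
    using assms by (auto intro!: divide_right_mono power_mono)
  thus "norm (1 - x / of_nat n) ^ 2 \<le> norm (1 - z / of_nat n) ^ 2" unfolding sq by linarith
qed auto

context
  fixes r :: real
  assumes r: "r > 0"
begin

private lemma weight_bounds: "0 \<le> poisson_weight r K n" "poisson_weight r K n \<le> 1"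
  using poisson_weight_bounds[OF r] by auto

private lemma abs_weight_mult_le: "\<bar>poisson_weight r K n * a\<bar> \<le> \<bar>a\<bar>" "\<bar>(1 - poisson_weight r K n) * a\<bar> \<le> \<bar>a\<bar>"
  using weight_bounds[of K n] mult_right_mono[of "poisson_weight r K n" 1 "\<bar>a\<bar>"]
    mult_right_mono[of "1 - poisson_weight r K n" 1 "\<bar>a\<bar>"] by (auto simp: abs_mult)

lemma weighted_prime_remainder_tendsto:
  assumes z: "norm z \<le> 1"
  shows "(\<lambda>K. \<Sum>n. poisson_weight r K n * prime_remainder z n) \<longlonglongrightarrow> Re (log_L_remainder (\<lambda>_. z) 1)"
    and "summable (\<lambda>n. poisson_weight r K n * prime_remainder z n)"
proof -
  have le: "norm (poisson_weight r K n * prime_remainder z n) \<le> 4 * (1 / real n ^ 2)" for K n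
    using abs_weight_mult_le(1)[of K n "prime_remainder z n"] norm_prime_term_le(1)[of "\<lambda>_. z" n] z
      abs_Re_le_cmod[of "log_remainder (on_primes (\<lambda>_. z) n / of_nat n)"] unfolding real_norm_def by linarith
  have "(\<lambda>K. \<Sum>n. poisson_weight r K n * prime_remainder z n) \<longlonglongrightarrow> suminf (prime_remainder z)"
  proof (rule suminf_dominated_convergence[OF _ le summable_inverse_squares_4])
    fix n
    show "(\<lambda>K. poisson_weight r K n * prime_remainder z n) \<longlonglongrightarrow> prime_remainder z n"
      using tendsto_mult_right[OF poisson_weight_tendsto[of n r], of "prime_remainder z n"]
      by (cases "n = 0") auto
  qed
  thus "(\<lambda>K. \<Sum>n. poisson_weight r K n * prime_remainder z n) \<longlonglongrightarrow> Re (log_L_remainder (\<lambda>_. z) 1)"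
    using Re_log_L_remainder_1[of "\<lambda>_. z"] z by (simp add: sums_iff)
  show "summable (\<lambda>n. poisson_weight r K n * prime_remainder z n)"
    using le by (intro summable_comparison_test'[OF summable_inverse_squares_4, of 0]) auto
qed

text \<open>In log L the prime power part has weight 1, whereas the prime sum is weighted. This
  series bounds the cost of weighting the former too, uniformly in the character.\<close>

lemma weight_defect_tendsto:
  shows "(\<lambda>K. \<Sum>n. (1 - poisson_weight r K n) * (4 * (1 / real n ^ 2))) \<longlonglongrightarrow> 0"
    and "summable (\<lambda>n. (1 - poisson_weight r K n) * (4 * (1 / real n ^ 2)))"
proof -
  have le: "norm ((1 - poisson_weight r K n) * (4 * (1 / real n ^ 2))) \<le> 4 * (1 / real n ^ 2)" for K n
    using abs_weight_mult_le(2)[of K n "4 * (1 / real n ^ 2)"] by simp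
  have "(\<lambda>K. \<Sum>n. (1 - poisson_weight r K n) * (4 * (1 / real n ^ 2))) \<longlonglongrightarrow> (\<Sum>n. 0)"
  proof (rule suminf_dominated_convergence[OF _ le summable_inverse_squares_4])
    fix n
    show "(\<lambda>K. (1 - poisson_weight r K n) * (4 * (1 / real n ^ 2))) \<longlonglongrightarrow> 0"
    proof (cases "n = 0")
      case False
      have "(\<lambda>K. (1 - poisson_weight r K n) * (4 * (1 / real n ^ 2))) \<longlonglongrightarrow> (1 - 1) * (4 * (1 / real n ^ 2))"
        using False by (intro tendsto_intros poisson_weight_tendsto) auto
      thus ?thesis by simp
    qed simp
  qed
  thus "(\<lambda>K. \<Sum>n. (1 - poisson_weight r K n) * (4 * (1 / real n ^ 2))) \<longlonglongrightarrow> 0" by simp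
  show "summable (\<lambda>n. (1 - poisson_weight r K n) * (4 * (1 / real n ^ 2)))"
    using le by (intro summable_comparison_test'[OF summable_inverse_squares_4, of 0]) auto
qed

private lemma weighted_sums:
  assumes "\<And>n. norm (c n) \<le> 1"
  shows "(\<lambda>n. poisson_weight r K n * Re (on_primes c n / of_nat n)) sums
     Re (\<Sum>n. on_primes c n / of_nat n * of_real (poisson_weight r K n))"
proof -
  note op = norm_on_primes_le[of c, OF assms]
  have "summable (\<lambda>n. norm (on_primes c n / of_nat n * of_real (poisson_weight r K n)))"
    by (rule taylor_truncation_eq_weighted_sum(2)[OF op r dirichlet_powser[OF op]])
  hence "(\<lambda>n. on_primes c n / of_nat n * of_real (poisson_weight r K n)) sums
     (\<Sum>n. on_primes c n / of_nat n * of_real (poisson_weight r K n))"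
    by (rule summable_sums[OF summable_norm_cancel])
  from sums_Re[OF this] show ?thesis by (simp add: mult.commute)
qed

private lemma weighted_const_sums:
  assumes z: "norm z \<le> 1"
  shows "(\<lambda>n. poisson_weight r K n * (Re (on_primes (\<lambda>_. z) n / of_nat n) + prime_remainder z n)) sums
    (Re z * Re (\<Sum>n. on_primes (\<lambda>_. 1) n / of_nat n * of_real (poisson_weight r K n)) +
      (\<Sum>n. poisson_weight r K n * prime_remainder z n))"
proof -
  have "(\<lambda>n. Re z * (poisson_weight r K n * Re (on_primes (\<lambda>_. 1) n / of_nat n))) sums
    (Re z * Re (\<Sum>n. on_primes (\<lambda>_. 1) n / of_nat n * of_real (poisson_weight r K n)))"
    by (intro sums_mult weighted_sums) auto
  also have "(\<lambda>n. Re z * (poisson_weight r K n * Re (on_primes (\<lambda>_. 1) n / of_nat n))) =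
     (\<lambda>n. poisson_weight r K n * Re (on_primes (\<lambda>_. z) n / of_nat n))"
    by (auto simp: on_primes_def)
  finally show ?thesis
    unfolding ring_distribs by (intro sums_add summable_sums weighted_prime_remainder_tendsto(2) z)
qed

private lemma weighted_log_sums:
  assumes "\<And>n. norm (c n) \<le> 1"
  shows "(\<lambda>n. poisson_weight r K n * Re (on_primes c n / of_nat n) + Re (log_remainder (on_primes c n / of_nat n)))
     sums (Re (\<Sum>n. on_primes c n / of_nat n * of_real (poisson_weight r K n)) + Re (log_L_remainder c 1))"
  using assms by (intro sums_add weighted_sums Re_log_L_remainder_1)

text \<open>Writing the weight 1 of the remainder as w + (1 - w) attaches w to the logarithm of the
  whole Euler factor. That logarithm can be compared at the extremal value of chi(p), while the
  linear term and the remainder need not be extremal at the same value.\<close>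

private lemma weighted_log_term:
  assumes "\<And>n. norm (c n) \<le> 1"
  shows "poisson_weight r K n * Re (on_primes c n / of_nat n) + Re (log_remainder (on_primes c n / of_nat n)) =
    poisson_weight r K n * (- ln (norm (1 - on_primes c n / of_nat n)))
     + (1 - poisson_weight r K n) * Re (log_remainder (on_primes c n / of_nat n))"
proof -
  have "w * a + b = w * (- L) + (1 - w) * b" if "b = - L - a" for w a b L :: real
    unfolding that by (simp add: algebra_simps)
  from this[OF Re_log_remainder[OF norm_prime_term_le(2)[of c, OF assms]]] show ?thesis .
qed

private lemma const_term:
  assumes "norm z \<le> 1"
  shows "Re (on_primes (\<lambda>_. z) n / of_nat n) + prime_remainder z n = - ln (norm (1 - on_primes (\<lambda>_. z) n / of_nat n))"
  using Re_log_remainder[OF norm_prime_term_le(2)[of "\<lambda>_. z"], of n] assms by simp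

private lemma defect_bound:
  assumes "\<And>n. norm (c n) \<le> 1"
  shows "\<bar>(1 - poisson_weight r K n) * Re (log_remainder (on_primes c n / of_nat n))\<bar>
     \<le> (1 - poisson_weight r K n) * (4 * (1 / real n ^ 2))"
proof -
  have "\<bar>Re (log_remainder (on_primes c n / of_nat n))\<bar> \<le> 4 * (1 / real n ^ 2)"
    using norm_prime_term_le(1)[of c n, OF assms] abs_Re_le_cmod order_trans by blast
  thus ?thesis unfolding abs_mult using weight_bounds[of K n] by (intro mult_mono) auto
qed

private lemma ln_norm_one_minus_mono:
  assumes c: "norm (c n) \<le> 1" and d: "norm (d n) \<le> 1" and le: "prime n \<Longrightarrow> Re (d n) \<le> Re (c n)" "prime n \<Longrightarrow> norm (c n) \<le> norm (d n)"
  shows "ln (norm (1 - on_primes c n / of_nat n)) \<le> ln (norm (1 - on_primes d n / of_nat n))"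
proof (cases "prime n")
  case True
  have "norm (c n / of_nat n) < 1" using c prime_gt_1_nat[OF True] by (simp add: norm_divide)
  hence "norm (1 - c n / of_nat n) > 0" by auto
  thus ?thesis using norm_one_minus_le[of "d n" "c n" n] le True
    by (auto simp: on_primes_def intro!: ln_mono)
qed (simp add: on_primes_def)

lemma weighted_log_lower:
  assumes c: "\<And>n. norm (c n) \<le> 1" and z: "norm z = 1" and Re: "\<And>n. Re z \<le> Re (c n)"
  shows "Re z * Re (\<Sum>n. on_primes (\<lambda>_. 1) n / of_nat n * of_real (poisson_weight r K n)) +
      (\<Sum>n. poisson_weight r K n * prime_remainder z n) - (\<Sum>n. (1 - poisson_weight r K n) * (4 * (1 / real n ^ 2)))
    \<le> Re (\<Sum>n. on_primes c n / of_nat n * of_real (poisson_weight r K n)) + Re (log_L_remainder c 1)"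
proof (rule sums_le[OF _ sums_diff[OF weighted_const_sums summable_sums[OF weight_defect_tendsto(2)]] weighted_log_sums[OF c]])
  fix n
  have z1: "norm z \<le> 1" using z by simp
  have "poisson_weight r K n * (- ln (norm (1 - on_primes (\<lambda>_. z) n / of_nat n))) \<le>
     poisson_weight r K n * (- ln (norm (1 - on_primes c n / of_nat n)))"
    using ln_norm_one_minus_mono[of c n "\<lambda>_. z"] c z Re weight_bounds by (intro mult_left_mono) auto
  thus "poisson_weight r K n * (Re (on_primes (\<lambda>_. z) n / of_nat n) + prime_remainder z n)
      - (1 - poisson_weight r K n) * (4 * (1 / real n ^ 2))
    \<le> poisson_weight r K n * Re (on_primes c n / of_nat n) + Re (log_remainder (on_primes c n / of_nat n))"
    unfolding weighted_log_term[OF c] const_term[OF z1] using defect_bound[of c K n, OF c] by linarith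
qed (use z in auto)

lemma weighted_log_upper:
  assumes c: "\<And>n. norm (c n) \<le> 1"
  shows "Re (\<Sum>n. on_primes c n / of_nat n * of_real (poisson_weight r K n)) + Re (log_L_remainder c 1)
    \<le> Re (\<Sum>n. on_primes (\<lambda>_. 1) n / of_nat n * of_real (poisson_weight r K n)) +
      (\<Sum>n. poisson_weight r K n * prime_remainder 1 n) + (\<Sum>n. (1 - poisson_weight r K n) * (4 * (1 / real n ^ 2)))"
proof -
  have "Re (\<Sum>n. on_primes c n / of_nat n * of_real (poisson_weight r K n)) + Re (log_L_remainder c 1)
    \<le> Re 1 * Re (\<Sum>n. on_primes (\<lambda>_. 1) n / of_nat n * of_real (poisson_weight r K n)) +
      (\<Sum>n. poisson_weight r K n * prime_remainder 1 n) + (\<Sum>n. (1 - poisson_weight r K n) * (4 * (1 / real n ^ 2)))"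
  proof (rule sums_le[OF _ weighted_log_sums[OF c] sums_add[OF weighted_const_sums summable_sums[OF weight_defect_tendsto(2)]]])
    fix n
    \<comment> \<open>\<open>ln_norm_one_minus_mono\<close> does not fit, because 1 may exceed the
      norm of c n. The triangle inequality |1 - c(p)/p| >= 1 - 1/p is used instead.\<close>
    have "ln (norm (1 - on_primes (\<lambda>_. 1) n / of_nat n :: complex)) \<le> ln (norm (1 - on_primes c n / of_nat n))"
    proof (cases "prime n")
      case True
      hence n: "n > 1" by (rule prime_gt_1_nat)
      have "norm (1 - 1 / of_nat n :: complex) = 1 - 1 / real n"
        using n norm_of_real[of "1 - 1 / real n", where 'a = complex] by simp
      moreover have "norm (c n / of_nat n) \<le> 1 / real n" using c[of n] by (simp add: norm_divide divide_right_mono)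
      moreover have "1 - norm (c n / of_nat n) \<le> norm (1 - c n / of_nat n)"
        using norm_triangle_ineq2[of 1 "c n / of_nat n"] by simp
      ultimately have "norm (1 - 1 / of_nat n :: complex) \<le> norm (1 - c n / of_nat n)" "norm (1 - 1 / of_nat n :: complex) > 0"
        using n by auto
      thus ?thesis using True by (simp add: on_primes_def ln_mono)
    qed (simp add: on_primes_def)
    hence "poisson_weight r K n * (- ln (norm (1 - on_primes c n / of_nat n))) \<le>
       poisson_weight r K n * (- ln (norm (1 - on_primes (\<lambda>_. 1) n / of_nat n :: complex)))"
      using weight_bounds by (intro mult_left_mono) auto
    thus "poisson_weight r K n * Re (on_primes c n / of_nat n) + Re (log_remainder (on_primes c n / of_nat n))
      \<le> poisson_weight r K n * (Re (on_primes (\<lambda>_. 1) n / of_nat n) + prime_remainder 1 n)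
        + (1 - poisson_weight r K n) * (4 * (1 / real n ^ 2))"
      unfolding weighted_log_term[OF c] const_term[of 1, OF eq_refl[OF norm_one]] using defect_bound[of c K n, OF c] by linarith
  qed auto
  thus ?thesis by simp
qed

end

text \<open>In the logarithm of each factor the linear terms - cos (pi/l) / p and cos (pi/l) / p
  cancel, which leaves two convergent remainder series. Convergence of the partial products is
  obtained along the way, so \<open>lim\<close> has its intended value.\<close>

lemma C_const_eq:
  fixes l :: nat
  defines "z \<equiv> - cis (pi / real l)"
  shows "C_const l = exp (cos (pi / real l) * Re (log_L_remainder (\<lambda>_. 1) 1) + Re (log_L_remainder (\<lambda>_. z) 1))"
proof -
  define c where "c = cos (pi / real l)"
  have nz: "norm z = 1" by (simp add: z_def)
  have "(\<lambda>n. c * prime_remainder 1 n + prime_remainder z n) sums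
     (c * Re (log_L_remainder (\<lambda>_. 1) 1) + Re (log_L_remainder (\<lambda>_. z) 1))"
    using nz by (intro sums_add sums_mult Re_log_L_remainder_1) auto
  hence "(\<lambda>N. exp (\<Sum>n\<le>N. c * prime_remainder 1 n + prime_remainder z n)) \<longlonglongrightarrow>
     exp (c * Re (log_L_remainder (\<lambda>_. 1) 1) + Re (log_L_remainder (\<lambda>_. z) 1))"
    unfolding sums_def_le by (rule tendsto_exp)
  also have "(\<lambda>N. exp (\<Sum>n\<le>N. c * prime_remainder 1 n + prime_remainder z n)) =
    (\<lambda>N. \<Prod>p\<in>{p. prime p \<and> p \<le> N}. (1 - 1 / real p) powr (- c) * (1 + 2 * c / real p + 1 / (real p)^2) powr (-1/2))"
  proof
    fix N :: nat
    have "exp (\<Sum>n\<le>N. c * prime_remainder 1 n + prime_remainder z n) = (\<Prod>n\<le>N. exp (c * prime_remainder 1 n + prime_remainder z n))"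
      by (simp add: exp_sum)
    also have "\<dots> = (\<Prod>p\<in>{p. prime p \<and> p \<le> N}. exp (c * prime_remainder 1 p + prime_remainder z p))"
      by (rule prod.mono_neutral_right) (auto simp: on_primes_def)
    also have "\<dots> = (\<Prod>p\<in>{p. prime p \<and> p \<le> N}. (1 - 1 / real p) powr (- c) * (1 + 2 * c / real p + 1 / (real p)^2) powr (-1/2))"
    proof (rule prod.cong[OF refl])
      fix p assume "p \<in> {p. prime p \<and> p \<le> N}"
      hence p: "prime p" "p > 1" using prime_gt_1_nat by auto
      have n1: "norm (1 - 1 / of_nat p :: complex) = 1 - 1 / real p"
        using p norm_of_real[of "1 - 1 / real p", where 'a = complex] by simp
      have e1: "prime_remainder 1 p = - ln (1 - 1 / real p) - 1 / real p"
        using Re_log_remainder[of "1 / of_nat p"] p n1 by (simp add: on_primes_def norm_divide)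
      have zp: "norm (z / of_nat p) < 1" using p nz by (simp add: norm_divide)
      hence pos: "norm (1 - z / of_nat p) > 0" by auto
      have sq: "norm (1 - z / of_nat p) ^ 2 = 1 + 2 * c / real p + 1 / (real p)^2"
      proof -
        have "norm (1 - v) ^ 2 = 1 - 2 * Re v + norm v ^ 2" for v :: complex
          unfolding cmod_power2 by (simp add: power2_eq_square algebra_simps)
        from this[of "z / of_nat p"] show ?thesis using nz by (simp add: norm_divide power_divide z_def c_def)
      qed
      have "ln (norm (1 - z / of_nat p)) = 1/2 * ln (1 + 2 * c / real p + 1 / (real p)^2)"
        using pos by (simp flip: sq add: ln_realpow)
      hence e2: "prime_remainder z p = - 1/2 * ln (1 + 2 * c / real p + 1 / (real p)^2) + c / real p"
        using Re_log_remainder[OF zp] p by (simp add: on_primes_def z_def c_def)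
      have e: "c * prime_remainder 1 p + prime_remainder z p =
        (- c) * ln (1 - 1 / real p) + (- 1/2) * ln (1 + 2 * c / real p + 1 / (real p)^2)"
        unfolding e1 e2 by (simp add: algebra_simps)
      have "1 + 2 * c / real p + 1 / (real p)^2 > 0" using pos by (simp flip: sq)
      thus "exp (c * prime_remainder 1 p + prime_remainder z p) =
         (1 - 1 / real p) powr (- c) * (1 + 2 * c / real p + 1 / (real p)^2) powr (-1/2)"
        unfolding e exp_add using p by (simp add: powr_def)
    qed
    finally show "exp (\<Sum>n\<le>N. c * prime_remainder 1 n + prime_remainder z n) =
       (\<Prod>p\<in>{p. prime p \<and> p \<le> N}. (1 - 1 / real p) powr (- c) * (1 + 2 * c / real p + 1 / (real p)^2) powr (-1/2))" .
  qed
  finally show ?thesis unfolding C_const_def c_def by (rule limI)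
qed

section \<open>Order of a character, choice of radii, and the final estimate\<close>

lemma dchar_order_power:
  assumes "dirichlet_char q chi" "dchar_order q chi = l" "coprime n q"
  shows "chi n ^ l = 1"
proof -
  \<comment> \<open>Euler's theorem supplies the witness needed to use \<open>LEAST\<close>.\<close>
  have "totient q > 0 \<and> (\<forall>n. coprime n q \<longrightarrow> chi n ^ totient q = 1)"
    using assms(1) dirichlet_char_power_totient[OF assms(1)] by (simp add: dirichlet_char_def)
  from LeastI[of "\<lambda>k. k > 0 \<and> (\<forall>n. coprime n q \<longrightarrow> chi n ^ k = 1)", OF this]
  show ?thesis using assms(2,3) by (simp add: dchar_order_def)
qed

lemma dchar_order_le_1_if_principal:
  assumes "principal_char q chi" shows "dchar_order q chi \<le> 1"
  unfolding dchar_order_def by (rule Least_le) (use assms in \<open>auto simp: principal_char_def\<close>)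

text \<open>For l = 2 m + 1, a character with trivial square equals its own l-th power, which is
  trivial. This makes the 3-4-1 argument available.\<close>

lemma square_nonprincipal:
  assumes chi: "dirichlet_char q chi" "\<not> principal_char q chi" and l: "odd l" "dchar_order q chi = l"
  shows "\<not> principal_char q (\<lambda>n. chi n ^ 2)"
proof
  assume p: "principal_char q (\<lambda>n. chi n ^ 2)"
  obtain m where m: "l = 2 * m + 1" using l(1) by (rule oddE)
  have "chi n = 1" if "coprime n q" for n
  proof -
    have "chi n ^ 2 = 1" using p that by (simp add: principal_char_def)
    moreover have "chi n ^ l = (chi n ^ 2) ^ m * chi n" by (simp add: m power_mult)
    ultimately show ?thesis using dchar_order_power[OF chi(1) l(2) that] by simp
  qed
  thus False using chi(2) by (simp add: principal_char_def)
qed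

text \<open>As r grows, r ln (1 + b/r) tends to b, so any b strictly between 1 / (2 + \<delta>) and
  1/2 works; the midpoint is taken. From ln (1 + x) >= x - x^2 it suffices that r exceeds b^2 / (b -
  1 / (2 + \<delta>)), and the added 1 also ensures b/r <= 1.\<close>

lemma exists_radii:
  assumes "\<delta> > (0::real)"
  shows "\<exists>r R'. 0 < r \<and> r < R' \<and> R' < r + 1/2 \<and> r * (2 + \<delta>) * ln (R' / r) > 1"
proof -
  define b where "b = (1/2 + 1 / (2 + \<delta>)) / 2"
  have lt: "1 / (2 + \<delta>) < 1/2" "0 < 1 / (2 + \<delta>)" using assms by (auto simp: field_simps)
  have "a < (1/2 + a) / 2 \<and> (1/2 + a) / 2 < 1/2 \<and> (1/2 + a) / 2 > 0" if "a < 1/2" "0 < a" for a :: real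
    using that by simp
  from this[OF lt] have b: "1 / (2 + \<delta>) < b" "b < 1/2" "b > 0" by (auto simp only: b_def)
  define r where "r = 1 + b ^ 2 / (b - 1 / (2 + \<delta>))"
  have q0: "b ^ 2 / (b - 1 / (2 + \<delta>)) > 0" using b by auto
  hence r: "r > 1" unfolding r_def by linarith
  have "b ^ 2 / (b - 1 / (2 + \<delta>)) < r" by (simp add: r_def)
  hence br: "b ^ 2 / r < b - 1 / (2 + \<delta>)" using b r by (simp add: field_simps)
  have "b / r - (b / r) ^ 2 \<le> ln (1 + b / r)"
    using b r by (intro ln_one_plus_pos_lower_bound) (auto simp: field_simps)
  hence "r * (b / r - (b / r) ^ 2) \<le> r * ln (1 + b / r)" using r by (intro mult_left_mono) auto
  moreover have "r * (b / r - (b / r) ^ 2) = b - b ^ 2 / r" using r by (simp add: field_simps power2_eq_square)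
  ultimately have "1 / (2 + \<delta>) < r * ln (1 + b / r)" using br by linarith
  hence "1 < (2 + \<delta>) * (r * ln (1 + b / r))" using assms by (simp add: field_simps)
  moreover have "1 + b / r = (r + b) / r" using r by (simp add: field_simps)
  ultimately have "r * (2 + \<delta>) * ln ((r + b) / r) > 1" by (simp add: mult_ac)
  thus ?thesis using r b by (intro exI[of _ r] exI[of _ "r + b"]) auto
qed

theorem theorem1p10:
  fixes l :: nat and eps :: real
  assumes "GRH" and "prime l" and "odd l" and "eps > 0"
  shows "\<exists>Q::nat. \<forall>q chi. q \<ge> Q \<and> dirichlet_char q chi \<and> dchar_order q chi = l
            \<and> dchar_conductor q chi = q \<longrightarrow>
           (1 - eps) * C_const l
              / (2 * exp euler_mascheroni * ln (ln (real q))) powr cos (pi / real l)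
             \<le> norm (dirichlet_L chi 1)
           \<and> norm (dirichlet_L chi 1) \<le> (1 + eps) * (2 * exp euler_mascheroni * ln (ln (real q)))"
proof -
  define c where "c = cos (pi / real l)"
  \<comment> \<open>The extremal value: for odd l this is an l-th root of unity as close to -1 as
    possible.\<close>
  define z where "z = - cis (pi / real l)"
  \<comment> \<open>Total error on the logarithmic scale: exp e = 1 + eps and exp (- e) = 1 / (1 +
    eps) >= 1 - eps. It is spent as e/4 on the truncation, e/4 on the limits in K, and e/2 on the
    ratio K / r.\<close>
  define e where "e = ln (1 + eps)"
  have l3: "l \<ge> 3" using prime_ge_2_nat[OF assms(2)] assms(3) by (cases "l = 2") auto
  have c: "0 \<le> c" "c \<le> 1"
  proof -
    have "pi / real l \<le> pi / 2" using l3 by (intro divide_left_mono) auto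
    moreover have "- (pi / 2) \<le> pi / real l" by (rule order_trans[of _ 0]) auto
    ultimately show "0 \<le> c" unfolding c_def by (intro cos_ge_zero)
  qed (simp add: c_def)
  have e: "e > 0" using assms(4) by (simp add: e_def)
  have nz: "norm z = 1" and Rez: "Re z = - c" by (simp_all add: z_def c_def)
  obtain r R' where r: "0 < r" "r < R'" "R' < r + 1/2" "r * (2 + e) * ln (R' / r) > 1"
    using exists_radii[OF e] by blast
  obtain B where B: "\<And>q chi K. q \<ge> 3 \<Longrightarrow> dirichlet_char q chi \<Longrightarrow> \<not> principal_char q chi \<Longrightarrow>
     \<not> principal_char q (\<lambda>n. chi n ^ 2) \<Longrightarrow>
     \<bar>ln (norm (dirichlet_L chi 1)) - (Re (\<Sum>n. on_primes chi n / of_nat n * of_real (poisson_weight r K n))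
        + Re (log_L_remainder chi 1))\<bar> \<le> B * ln (real q) * (r / R') ^ K"
    using log_norm_L_approx[OF assms(1) r(1,2,3)] by blast
  define V where "V = (\<lambda>K. Re (\<Sum>n. on_primes (\<lambda>_. 1) n / of_nat n * of_real (poisson_weight r K n)))"
  define F where "F = (\<lambda>z K. \<Sum>n. poisson_weight r K n * prime_remainder z n)"
  define T where "T = (\<lambda>K. \<Sum>n. (1 - poisson_weight r K n) * (4 * (1 / real n ^ 2)))"
  define D where "D = (\<lambda>z. Re (log_L_remainder (\<lambda>_. z) 1))"
  have limV: "(\<lambda>K. V K - ln (real K)) \<longlonglongrightarrow> euler_mascheroni - ln r - D 1"
    unfolding V_def D_def by (rule weighted_prime_sum_asymptotics[OF r(1)])
  have limF: "F w \<longlonglongrightarrow> D w" if "norm w \<le> 1" for w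
    unfolding F_def D_def by (rule weighted_prime_remainder_tendsto(1)[OF r(1) that])
  have limT: "T \<longlonglongrightarrow> 0" unfolding T_def by (rule weight_defect_tendsto(1)[OF r(1)])
  \<comment> \<open>The prime power constant \<open>D 1\<close> cancels, which is why the upper
    bound has only Euler's constant.\<close>
  have "(\<lambda>K. (V K - ln (real K)) + F 1 K + T K) \<longlonglongrightarrow> (euler_mascheroni - ln r - D 1) + D 1 + 0"
    by (intro tendsto_add limV limF limT) simp
  hence up: "(\<lambda>K. (V K - ln (real K)) + F 1 K + T K) \<longlonglongrightarrow> euler_mascheroni - ln r" by simp
  have evU: "\<forall>\<^sub>F K in sequentially. (V K - ln (real K)) + F 1 K + T K < euler_mascheroni - ln r + e / 4"
    by (rule order_tendstoD(2)[OF up]) (use e in simp)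
  \<comment> \<open>Here the prime power constants do not cancel; what is left, c D 1 + D z, is the
    logarithm of C_l.\<close>
  have "(\<lambda>K. (- c) * (V K - ln (real K)) + F z K - T K) \<longlonglongrightarrow> (- c) * (euler_mascheroni - ln r - D 1) + D z - 0"
    using nz by (intro tendsto_add tendsto_diff tendsto_mult tendsto_const limV limF limT) simp
  hence lo: "(\<lambda>K. (- c) * (V K - ln (real K)) + F z K - T K) \<longlonglongrightarrow> - c * (euler_mascheroni - ln r) + (c * D 1 + D z)"
    by (simp add: algebra_simps)
  have evL: "\<forall>\<^sub>F K in sequentially. (- c) * (V K - ln (real K)) + F z K - T K > - c * (euler_mascheroni - ln r) + (c * D 1 + D z) - e / 4"
    by (rule order_tendstoD(1)[OF lo]) (use e in simp)
  have C: "C_const l = exp (c * D 1 + D z)"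
    unfolding D_def c_def z_def by (rule C_const_eq)

  text \<open>With this choice of \<open>K\<close> the error of the Taylor truncation is a negative power of \<open>ln q\<close>.\<close>
  define X where "X = (\<lambda>q::nat. (2 + e) * ln (ln (real q)))"
  define K where "K = (\<lambda>q. nat \<lfloor>r * X q\<rfloor>)"
  define \<kappa> where "\<kappa> = r * (2 + e) * ln (R' / r)"
  have lnq: "filterlim (\<lambda>q. ln (real q)) at_top sequentially"
    by (rule filterlim_compose[OF ln_at_top filterlim_real_sequentially])
  have lnlnq: "filterlim (\<lambda>q. ln (ln (real q))) at_top sequentially"
    by (rule filterlim_compose[OF ln_at_top lnq])
  have rX: "filterlim (\<lambda>q. r * X q) at_top sequentially"
    unfolding X_def using r e
    by (intro filterlim_tendsto_pos_mult_at_top[OF tendsto_const] lnlnq) auto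
  have Kinf: "filterlim K at_top sequentially"
    unfolding K_def
    by (rule filterlim_compose[OF filterlim_nat_sequentially filterlim_compose[OF filterlim_floor_sequentially rX]])
  have "(\<lambda>q. \<bar>B\<bar> * (R' / r) * ln (real q) powr (1 - \<kappa>)) \<longlonglongrightarrow> \<bar>B\<bar> * (R' / r) * 0"
    using r by (intro tendsto_mult tendsto_const tendsto_neg_powr lnq) (simp add: \<kappa>_def)
  hence ev4: "\<forall>\<^sub>F q in sequentially. \<bar>B\<bar> * (R' / r) * ln (real q) powr (1 - \<kappa>) < e / 4"
    using e by (intro order_tendstoD(2)) auto
  have "\<forall>\<^sub>F q in sequentially. q \<ge> 3 \<and> ln (real q) > 0 \<and> ln (ln (real q)) > 0 \<and> K q \<ge> 1 \<and>
     (V (K q) - ln (real (K q))) + F 1 (K q) + T (K q) < euler_mascheroni - ln r + e / 4 \<and>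
     (- c) * (V (K q) - ln (real (K q))) + F z (K q) - T (K q) > - c * (euler_mascheroni - ln r) + (c * D 1 + D z) - e / 4 \<and>
     \<bar>B\<bar> * (R' / r) * ln (real q) powr (1 - \<kappa>) < e / 4"
    using lnq lnlnq Kinf
    by (intro eventually_conj eventually_ge_at_top ev4
          eventually_compose_filterlim[OF evU Kinf] eventually_compose_filterlim[OF evL Kinf])
       (auto simp: filterlim_at_top_dense filterlim_at_top)
  then obtain Q where Q: "\<And>q. q \<ge> Q \<Longrightarrow> q \<ge> 3 \<and> ln (real q) > 0 \<and> ln (ln (real q)) > 0 \<and> K q \<ge> 1 \<and>
     (V (K q) - ln (real (K q))) + F 1 (K q) + T (K q) < euler_mascheroni - ln r + e / 4 \<and>
     (- c) * (V (K q) - ln (real (K q))) + F z (K q) - T (K q) > - c * (euler_mascheroni - ln r) + (c * D 1 + D z) - e / 4 \<and>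
     \<bar>B\<bar> * (R' / r) * ln (real q) powr (1 - \<kappa>) < e / 4"
    unfolding eventually_sequentially by blast
  show ?thesis
  proof (intro exI[of _ Q] allI impI, elim conjE)
    fix q chi
    assume qQ: "q \<ge> Q" and chi: "dirichlet_char q chi" and ord: "dchar_order q chi = l"
    have q: "q \<ge> 3" "ln (real q) > 0" "ln (ln (real q)) > 0" "K q \<ge> 1"
      and U: "(V (K q) - ln (real (K q))) + F 1 (K q) + T (K q) < euler_mascheroni - ln r + e / 4"
      and L: "(- c) * (V (K q) - ln (real (K q))) + F z (K q) - T (K q) > - c * (euler_mascheroni - ln r) + (c * D 1 + D z) - e / 4"
      and err: "\<bar>B\<bar> * (R' / r) * ln (real q) powr (1 - \<kappa>) < e / 4"
      using Q[OF qQ] by auto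
    have np: "\<not> principal_char q chi"
      using dchar_order_le_1_if_principal[of q chi] ord l3 by auto
    note np2 = square_nonprincipal[OF chi np assms(3) ord]
    have chi1: "norm (chi n) \<le> 1" for n by (rule norm_dirichlet_char_le[OF chi])
    have Rechi: "Re z \<le> Re (chi n)" for n
    proof (cases "coprime n q")
      case True
      thus ?thesis unfolding Rez c_def
        by (intro Re_root_of_unity_ge assms(3) dchar_order_power[OF chi ord])
    next
      case False
      \<comment> \<open>The value 0 is admissible because l >= 3 makes cos (pi/l) nonnegative, so Re
        z <= 0.\<close>
      hence "chi n = 0" using chi unfolding dirichlet_char_def by blast
      thus ?thesis using Rez c by simp
    qed
    define S where "S = Re (\<Sum>n. on_primes chi n / of_nat n * of_real (poisson_weight r (K q) n)) + Re (log_L_remainder chi 1)"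
    define LL where "LL = ln (norm (dirichlet_L chi 1))"
    have normL: "norm (dirichlet_L chi 1) = exp LL"
      using dirichlet_L_nonzero_Re_1[OF chi np np2, of 1] by (simp add: LL_def)
    have Xpos: "X q > 0" using q e by (simp add: X_def)
    have Kle: "real (K q) \<le> r * X q" "r * X q < real (K q) + 1"
      using r Xpos by (auto simp: K_def)
    \<comment> \<open>Rounding K down loses less than one factor R' / r.\<close>
    have pw: "(r / R') ^ K q \<le> (R' / r) * ln (real q) powr (- \<kappa>)"
    proof -
      have pos: "ln (R' / r) > 0" "R' / r > 0" using r by auto
      have "(r / R') ^ K q = (1 / (R' / r)) ^ K q" by simp
      also have "\<dots> = exp (- (real (K q) * ln (R' / r)))"
        using pos by (simp add: power_divide exp_minus exp_of_nat_mult inverse_eq_divide)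
      also have "- (real (K q) * ln (R' / r)) \<le> ln (R' / r) - \<kappa> * ln (ln (real q))"
      proof -
        have "r * X q * ln (R' / r) \<le> (real (K q) + 1) * ln (R' / r)"
          using Kle pos by (intro mult_right_mono) auto
        thus ?thesis by (simp add: X_def \<kappa>_def algebra_simps)
      qed
      also have "exp (ln (R' / r) - \<kappa> * ln (ln (real q))) = (R' / r) * ln (real q) powr (- \<kappa>)"
        using pos q by (simp add: exp_diff powr_def exp_minus divide_inverse)
      finally show ?thesis by simp
    qed
    have "\<bar>LL - S\<bar> \<le> B * ln (real q) * (r / R') ^ K q"
      unfolding LL_def S_def by (rule B[OF q(1) chi np np2])
    also have "\<dots> \<le> \<bar>B\<bar> * ln (real q) * ((R' / r) * ln (real q) powr (- \<kappa>))"
      using pw q r by (intro mult_mono) auto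
    also have "\<dots> = \<bar>B\<bar> * (R' / r) * (ln (real q) powr 1 * ln (real q) powr (- \<kappa>))" using q by simp
    also have "\<dots> = \<bar>B\<bar> * (R' / r) * ln (real q) powr (1 - \<kappa>)" by (simp only: powr_add[symmetric]) simp
    finally have LS: "\<bar>LL - S\<bar> < e / 4" using err by linarith
    define M where "M = ln (2 * exp euler_mascheroni * ln (ln (real q)))"
    have Mexp: "exp M = 2 * exp euler_mascheroni * ln (ln (real q))" using q by (simp add: M_def)
    \<comment> \<open>K / r is at most (2 + e) log log q, which is 1 + e/2 times 2 log log q, and ln
      (1 + e/2) <= e/2. An upper bound for K serves both estimates, because the prime sum enters the
      lower one with the factor - c <= 0.\<close>
    have KM: "ln (real (K q)) + euler_mascheroni - ln r \<le> M + e / 2"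
    proof -
      have "ln (real (K q)) \<le> ln (r * X q)" using Kle q by (intro ln_mono) auto
      also have "\<dots> = ln r + ln (X q)" using r Xpos by (simp add: ln_mult)
      also have "X q = (1 + e / 2) * (2 * ln (ln (real q)))" by (simp add: X_def algebra_simps)
      also have "ln \<dots> = ln (1 + e / 2) + ln (2 * ln (ln (real q)))" using e q by (subst ln_mult) auto
      also have "ln (1 + e / 2) \<le> e / 2" using e by (intro ln_add_one_self_le_self) auto
      also have "ln (2 * ln (ln (real q))) = M - euler_mascheroni"
        using q by (simp add: M_def ln_mult)
      finally show ?thesis by simp
    qed
    have "S \<le> V (K q) + F 1 (K q) + T (K q)"
      unfolding S_def V_def F_def T_def by (rule weighted_log_upper[OF r(1) chi1])
    hence "LL \<le> M + e" using LS U KM by linarith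
    hence "exp LL \<le> exp (M + e)" by simp
    also have "\<dots> = (1 + eps) * (2 * exp euler_mascheroni * ln (ln (real q)))"
      using assms(4) Mexp by (simp add: exp_add e_def)
    finally have upper: "norm (dirichlet_L chi 1) \<le> (1 + eps) * (2 * exp euler_mascheroni * ln (ln (real q)))"
      by (simp add: normL)
    have "- c * V (K q) + F z (K q) - T (K q) \<le> S"
      using weighted_log_lower[OF r(1) chi1 nz Rechi, of "K q"] unfolding S_def V_def F_def T_def Rez by simp
    hence "LL > - c * (ln (real (K q)) + euler_mascheroni - ln r) + (c * D 1 + D z) - e / 2"
      using LS L unfolding right_diff_distrib distrib_left by linarith
    moreover have "c * (ln (real (K q)) + euler_mascheroni - ln r) \<le> c * (M + e / 2)"
      using KM c by (intro mult_left_mono) auto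
    moreover have "c * (e / 2) \<le> e / 2" using c e mult_right_mono[of c 1 "e / 2"] by simp
    ultimately have "LL \<ge> (c * D 1 + D z) - c * M - e" by (simp add: ring_distribs)
    hence "exp ((c * D 1 + D z) - c * M - e) \<le> norm (dirichlet_L chi 1)" by (simp add: normL)
    moreover have "exp ((c * D 1 + D z) - c * M - e) = exp (- e) * C_const l / (2 * exp euler_mascheroni * ln (ln (real q))) powr c"
    proof -
      have "(2 * exp euler_mascheroni * ln (ln (real q))) powr c = exp (c * M)"
        using Mexp by (simp flip: Mexp add: powr_def)
      thus ?thesis by (simp add: C exp_diff exp_minus divide_inverse)
    qed
    moreover have "(1 - eps) * C_const l / (2 * exp euler_mascheroni * ln (ln (real q))) powr c \<le>
       exp (- e) * C_const l / (2 * exp euler_mascheroni * ln (ln (real q))) powr c"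
    proof (intro divide_right_mono mult_right_mono)
      have "(1 - eps) * (1 + eps) \<le> 1" by (simp add: algebra_simps)
      hence "1 - eps \<le> 1 / (1 + eps)" using assms(4) by (simp add: pos_le_divide_eq)
      thus "1 - eps \<le> exp (- e)" using assms(4) by (simp add: e_def exp_minus inverse_eq_divide)
    qed (auto simp: C)
    ultimately have "(1 - eps) * C_const l / (2 * exp euler_mascheroni * ln (ln (real q))) powr c \<le> norm (dirichlet_L chi 1)"
      by linarith
    thus "(1 - eps) * C_const l / (2 * exp euler_mascheroni * ln (ln (real q))) powr cos (pi / real l)
             \<le> norm (dirichlet_L chi 1)
           \<and> norm (dirichlet_L chi 1) \<le> (1 + eps) * (2 * exp euler_mascheroni * ln (ln (real q)))"
      using upper by (simp add: c_def)
  qed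
qed

end
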